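(* Let $\mathfrak S\subset\mathfrak P(X)$ be an interval system and $\mu:\mathfrak S\to\mathbb R$ a measure. Suppose that $f:X\to\mathbb R$ is integrable (with respect to ordinary multiplication and $\mu$) and that $\operatorname{svar}(f,\mu)$ is bounded. Then for arbitrary $\varepsilon>0$ there exist countable families $c_\lambda\in\mathbb R$, $E_\lambda\in\mathfrak S$ ($\lambda\in\Lambda$) such that for each $x\in X$ either $$f(x)=\sum^{\mathrm{abs}}_{\lambda\in\Lambda}c_\lambda\chi_{E_\lambda}(x),$$ or the sum on the right side is completely divergent (meaning that the sum of its positive terms and the sum of its negative terms are both infinite); and $$\sum_{\lambda\in\Lambda}\operatorname{svar}(c_\lambda,E_\lambda,\mu)\subset\operatorname{svar}(f,\mu)+(-\varepsilon,\varepsilon).$$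
   Context: Conventions. "Countable" includes finite. Neighborhoods need not be open. $\mathfrak P(X)$ is the power set of $X$. Interval system: a family $\mathfrak S\subset\mathfrak P(X)$ such that for all $A,B\in\mathfrak S$ each of $A\setminus B$ and $A\cap B$ is the union of a countable family of pairwise disjoint elements of $\mathfrak S$. $\sum^{\mathrm{abs}}$ denotes the sum of an absolutely convergent countable family of reals. For countably many sets $A_\lambda\subset\mathbb R$ with $0\in A_\lambda$ for all but finitely many $\lambda$, $\sum_\lambda A_\lambda$ is the set of all sums $\sum_\lambda a_\lambda$ with $a_\lambda\in A_\lambda$ and only finitely many $a_\lambda\neq0$. Measure: $\mu:\mathfrak S\to\mathbb R$ with $\mu(A)=\sum^{\mathrm{abs}}_\lambda\mu(A_\lambda)$ whenever $A\in\mathfrak S$ is a countable disjoint union of $A_\lambda\in\mathfrak S$. Step-function: $s=\sum_{j\in J}c_j\chi_{E_j}$ with $J$ finite, $c_j\in\mathbb R$, $E_j\in\mathfrak S$. Envelope: for $\mathcal A\subset\mathbb R\times X$, $D\subset X$ put $\mathcal A^D=\{v:(v,x)\in\mathcal A\ \forall x\in D\}$. $\mathcal A$ is an envelope if it contains the graph $\{(s(x),x):x\in X\}$ of some step-function and there is a countable $\mathfrak D\subset\mathfrak S$ with $\mathcal A=\bigl(\bigcup_{D\in\mathfrak D}\mathcal A^D\times D\bigr)\cup\bigl(\{0\}\times(X\setminus\bigcup\mathfrak D)\bigr)$. $\int^{\mathrm p}(\mathcal A,\mu)$ is the closure of the set of all $\sum_{j\in J}c_j\mu(E_j)$ with $J$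 finite, $c_j\in\mathbb R$, $E_j\in\mathfrak S$, and the graph of $\sum_jc_j\chi_{E_j}$ contained in $\mathcal A$. Integral: $f:X\to\mathbb R$ is integrable with $\int f\,\mu=a$ if for each neighborhood $\mathcal T$ of $0$ in $\mathbb R$ there is an envelope $\mathcal A$ containing the graph of $f$ with $\int^{\mathrm p}(\mathcal A,\mu)\subset a+\mathcal T$. If $f$ is integrable, then for every $A\in\mathfrak S$ the function $f|_A$ (equal to $f$ on $A$ and $0$ elsewhere) is integrable. Semivariation: $\operatorname{svar}(f,\mu)$ is the closure of the set of all $\sum_{j\in J}\int f|_{A_j}\,\mu$ with $J$ finite and $A_j\in\mathfrak S$ pairwise disjoint. For $c\in\mathbb R$, $E\in\mathfrak S$, $\operatorname{svar}(c,E,\mu)$ is the closure of the set of all $\sum_{j\in J}c\,\mu(A_j)$ with $J$ finite and $A_j\in\mathfrak S$ pairwise disjoint, $A_j\subset E$. *)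

theory Defs
  imports "HOL-Analysis.Analysis"
begin

(* The ground set X is an explicit carrier 'a set, possibly empty. Functions on X are total on 'a,
   but only their values on X are used; likewise only the values of \<mu> on \<SS> are used.
   Finite families are indexed by finite sets of naturals, countable families (finite ones
   included) by arbitrary sets of naturals. *)

definition countable_disjoint_union ::
    "'a set set \<Rightarrow> nat set \<Rightarrow> (nat \<Rightarrow> 'a set) \<Rightarrow> 'a set \<Rightarrow> bool" where
  "countable_disjoint_union \<SS> \<Lambda> C A \<longleftrightarrow>
     (\<forall>l\<in>\<Lambda>. C l \<in> \<SS>) \<and> disjoint_family_on C \<Lambda> \<and> (\<Union>l\<in>\<Lambda>. C l) = A"

definition interval_system :: "'a set \<Rightarrow> 'a set set \<Rightarrow> bool" where
  "interval_system X \<SS> \<longleftrightarrow> \<SS> \<subseteq> Pow X \<and>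
     (\<forall>A\<in>\<SS>. \<forall>B\<in>\<SS>. (\<exists>\<Lambda> C. countable_disjoint_union \<SS> \<Lambda> C (A - B)) \<and>
                    (\<exists>\<Lambda> C. countable_disjoint_union \<SS> \<Lambda> C (A \<inter> B)))"

definition has_abs_sum :: "('i \<Rightarrow> real) \<Rightarrow> 'i set \<Rightarrow> real \<Rightarrow> bool" where
  "has_abs_sum g \<Lambda> a \<longleftrightarrow> (\<lambda>l. \<bar>g l\<bar>) summable_on \<Lambda> \<and> (g has_sum a) \<Lambda>"

definition completely_divergent :: "('i \<Rightarrow> real) \<Rightarrow> 'i set \<Rightarrow> bool" where
  "completely_divergent g \<Lambda> \<longleftrightarrow>
     (\<Sum>\<^sub>\<infinity>l\<in>{l\<in>\<Lambda>. g l > 0}. ennreal (g l)) = \<infinity> \<and>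
     (\<Sum>\<^sub>\<infinity>l\<in>{l\<in>\<Lambda>. g l < 0}. ennreal (- g l)) = \<infinity>"

(* The sum of sets \<Sum>\<^sub>\<lambda> A\<^sub>\<lambda>; only meaningful if 0 \<in> A\<^sub>\<lambda> for all but finitely many \<lambda>. *)
definition set_family_sum :: "'i set \<Rightarrow> ('i \<Rightarrow> real set) \<Rightarrow> real set" where
  "set_family_sum \<Lambda> A = {(\<Sum>l\<in>{l. l \<in> \<Lambda> \<and> a l \<noteq> 0}. a l) | a.
     (\<forall>l\<in>\<Lambda>. a l \<in> A l) \<and> finite {l. l \<in> \<Lambda> \<and> a l \<noteq> 0}}"

definition abs_additive_measure :: "'a set set \<Rightarrow> ('a set \<Rightarrow> real) \<Rightarrow> bool" where
  "abs_additive_measure \<SS> \<mu> \<longleftrightarrow>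
     (\<forall>A\<in>\<SS>. \<forall>\<Lambda> C. countable_disjoint_union \<SS> \<Lambda> C A \<longrightarrow> has_abs_sum (\<lambda>l. \<mu> (C l)) \<Lambda> (\<mu> A))"

definition step_sum :: "nat set \<Rightarrow> (nat \<Rightarrow> real) \<Rightarrow> (nat \<Rightarrow> 'a set) \<Rightarrow> 'a \<Rightarrow> real" where
  "step_sum J c E x = (\<Sum>j\<in>J. c j * indicator (E j) x)"

definition step_function :: "'a set set \<Rightarrow> ('a \<Rightarrow> real) \<Rightarrow> bool" where
  "step_function \<SS> s \<longleftrightarrow> (\<exists>J c E. finite J \<and> (\<forall>j\<in>J. E j \<in> \<SS>) \<and> s = step_sum J c E)"

(* Values come first, as in the usual notation for envelopes. *)
definition graph_on :: "'a set \<Rightarrow> ('a \<Rightarrow> real) \<Rightarrow> (real \<times> 'a) set" where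
  "graph_on X f = {(f x, x) | x. x \<in> X}"

definition const_fibre :: "(real \<times> 'a) set \<Rightarrow> 'a set \<Rightarrow> real set" where
  "const_fibre \<A> D = {v. \<forall>x\<in>D. (v, x) \<in> \<A>}"

definition envelope :: "'a set \<Rightarrow> 'a set set \<Rightarrow> (real \<times> 'a) set \<Rightarrow> bool" where
  "envelope X \<SS> \<A> \<longleftrightarrow> \<A> \<subseteq> UNIV \<times> X \<and>
     (\<exists>s. step_function \<SS> s \<and> graph_on X s \<subseteq> \<A>) \<and>
     (\<exists>\<D>. countable \<D> \<and> \<D> \<subseteq> \<SS> \<and>
          \<A> = (\<Union>D\<in>\<D>. const_fibre \<A> D \<times> D) \<union> ({0} \<times> (X - \<Union>\<D>)))"

definition env_integral ::
    "'a set \<Rightarrow> 'a set set \<Rightarrow> ('a set \<Rightarrow> real) \<Rightarrow> (real \<times> 'a) set \<Rightarrow> real set" where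
  "env_integral X \<SS> \<mu> \<A> = closure {(\<Sum>j\<in>J. c j * \<mu> (E j)) | J c E.
     finite J \<and> (\<forall>j\<in>J. E j \<in> \<SS>) \<and> graph_on X (step_sum J c E) \<subseteq> \<A>}"

(* 0 \<in> interior T says that T is a (not necessarily open) neighbourhood of 0. *)
definition has_env_integral ::
    "'a set \<Rightarrow> 'a set set \<Rightarrow> ('a set \<Rightarrow> real) \<Rightarrow> ('a \<Rightarrow> real) \<Rightarrow> real \<Rightarrow> bool" where
  "has_env_integral X \<SS> \<mu> f a \<longleftrightarrow>
     (\<forall>T. 0 \<in> interior T \<longrightarrow>
        (\<exists>\<A>. envelope X \<SS> \<A> \<and> graph_on X f \<subseteq> \<A> \<and> env_integral X \<SS> \<mu> \<A> \<subseteq> a +o T))"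

definition env_integrable ::
    "'a set \<Rightarrow> 'a set set \<Rightarrow> ('a set \<Rightarrow> real) \<Rightarrow> ('a \<Rightarrow> real) \<Rightarrow> bool" where
  "env_integrable X \<SS> \<mu> f \<longleftrightarrow> (\<exists>a. has_env_integral X \<SS> \<mu> f a)"

(* Unspecified if f is not integrable. *)
definition the_env_integral ::
    "'a set \<Rightarrow> 'a set set \<Rightarrow> ('a set \<Rightarrow> real) \<Rightarrow> ('a \<Rightarrow> real) \<Rightarrow> real" where
  "the_env_integral X \<SS> \<mu> f = (THE a. has_env_integral X \<SS> \<mu> f a)"

definition restrict_zero :: "('a \<Rightarrow> real) \<Rightarrow> 'a set \<Rightarrow> 'a \<Rightarrow> real" where
  "restrict_zero f A x = (if x \<in> A then f x else 0)"

definition svar :: "'a set \<Rightarrow> 'a set set \<Rightarrow> ('a set \<Rightarrow> real) \<Rightarrow> ('a \<Rightarrow> real) \<Rightarrow> real set" where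
  "svar X \<SS> \<mu> f = closure {(\<Sum>j\<in>J. the_env_integral X \<SS> \<mu> (restrict_zero f (A j))) | J A.
     finite (J :: nat set) \<and> (\<forall>j\<in>J. A j \<in> \<SS>) \<and> disjoint_family_on A J}"

definition svar_const :: "'a set set \<Rightarrow> ('a set \<Rightarrow> real) \<Rightarrow> real \<Rightarrow> 'a set \<Rightarrow> real set" where
  "svar_const \<SS> \<mu> c E = closure {(\<Sum>j\<in>J. c * \<mu> (A j)) | J A.
     finite (J :: nat set) \<and> (\<forall>j\<in>J. A j \<in> \<SS> \<and> A j \<subseteq> E) \<and> disjoint_family_on A J}"

end

theory Submission
  imports Defs
begin

text \<open>
  Choose envelopes \<open>\<A>\<^sub>n\<close> of \<open>f\<close> whose integrals have oscillation at most \<open>\<eta> / 4\<^sup>n\<close>, and a countable union \<open>W\<close>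
  of members of the interval system outside which \<open>f\<close> vanishes. For each \<open>n\<close> there is a function \<open>F\<^sub>n\<close>,
  constant on the members of a countable partition of \<open>W\<close>, whose values are compatible with \<open>\<A>\<^sub>n\<close>.
  By a Saks-Henstock estimate, sums of \<open>F\<^sub>0 \<mu>\<close> over disjoint sets differ by at most \<open>\<eta>\<close> from elements
  of the semivariation of \<open>f\<close>, and sums of \<open>(F\<^sub>n - F\<^sub>n\<^sub>-\<^sub>1) \<mu>\<close> are of order \<open>\<eta> / 4\<^sup>n\<close>. So the series
  \<open>F\<^sub>0 + (F\<^sub>1 - F\<^sub>0) + \<dots>\<close> has the required semivariation, but it may fail to converge to \<open>f\<close> at points that lie in
  infinitely many of the bad sets \<open>B\<^sub>n\<close> containing \<open>{x. \<bar>f x - F\<^sub>n x\<bar> > 1 / 2\<^sup>n}\<close>. These carry \<open>\<mu>\<close>-mass at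
  most \<open>\<eta> / 2\<^sup>n\<close>, so the terms \<open>+1\<close> and \<open>-1\<close> on \<open>B\<^sub>n\<close> may be added: they cancel at points in
  finitely many \<open>B\<^sub>n\<close> and force complete divergence at all others.
\<close>

section \<open>Countable partitions into members of an interval system\<close>

text \<open>Step functions are finite, whereas intersections and differences of members are only
  countable unions of members, so \<open>f\<close> cannot be cut down to a member, nor two envelopes
  compared on a common partition, within finite step functions. Estimates are therefore proved for
  finite disjoint families and carried over to countable partitions by unconditional summation.
  \<open>\<mu>\<close> may have infinite variation on a member, so no bound can come from its
  variation. The bounds come from exchange: over disjoint sets, two values from the fibres of an
  envelope can be interchanged set by set, and the favourable choice of signs turns the oscillation
  into a bound on a sum of absolute values. The rates 4^(-n) and 2^(-n) are matched: values more
  than 2^(-n) apart on sets of an envelope with oscillation \<open>\<eta> / 4 ^ n\<close> leave mass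
  \<open>\<eta> / 2 ^ n\<close>, which can still be summed over n, and deviations 2^(-n) off the bad
  sets still make the telescoping series converge absolutely. Integrability of the restrictions of
  \<open>f\<close>, on which the semivariation relies, is derived along the way.\<close>

locale interval_measure =
  fixes X :: "'a set" and \<SS> :: "'a set set" and \<mu> :: "'a set \<Rightarrow> real"
  assumes isys: "interval_system X \<SS>"
    and abs_add: "abs_additive_measure \<SS> \<mu>"
begin

text \<open>A set of blocks replaces the indexed family. Empty blocks, the only ones that a disjoint
  family can repeat, are dropped, so sums over \<open>P\<close> need no indexing.\<close>

definition spart :: "'a set \<Rightarrow> 'a set set \<Rightarrow> bool" where
  "spart U P \<longleftrightarrow> partition_on U P \<and> countable P \<and> P \<subseteq> \<SS>"

lemma spartD:
  assumes "spart U P"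
  shows "\<Union>P = U" "disjoint P" "{} \<notin> P" "countable P" "P \<subseteq> \<SS>"
  using assms by (auto simp: spart_def partition_on_def)

lemma spartI:
  assumes "\<Union>P = U" "disjoint P" "{} \<notin> P" "countable P" "P \<subseteq> \<SS>"
  shows "spart U P"
  using assms by (auto simp: spart_def partition_on_def)

lemma sub_X: "A \<in> \<SS> \<Longrightarrow> A \<subseteq> X"
  using isys by (auto simp: interval_system_def)

section \<open>Disjoint families and partitions\<close>

lemma spart_of_family:
  assumes "countable_disjoint_union \<SS> \<Lambda> C A"
  shows "spart A (C ` \<Lambda> - {{}})"
proof (rule spartI)
  have d: "disjoint_family_on C \<Lambda>" using assms by (simp add: countable_disjoint_union_def)
  then show "disjoint (C ` \<Lambda> - {{}})"
    unfolding disjoint_def disjoint_family_on_def by (metis DiffE imageE)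
qed (use assms in \<open>auto simp: countable_disjoint_union_def\<close>)

lemma family_of_spart:
  assumes "spart A P"
  shows "countable_disjoint_union \<SS> (to_nat_on P ` P) (from_nat_into P) A"
  unfolding countable_disjoint_union_def
proof (intro conjI)
  note P = spartD[OF assms]
  have e: "from_nat_into P (to_nat_on P p) = p" if "p \<in> P" for p
    using that P(4) by simp
  show "\<forall>l\<in>to_nat_on P ` P. from_nat_into P l \<in> \<SS>" using e P(5) by auto
  show "disjoint_family_on (from_nat_into P) (to_nat_on P ` P)"
    using e P(2) unfolding disjoint_family_on_def disjoint_def by (metis imageE)
  show "\<Union> (from_nat_into P ` to_nat_on P ` P) = A" using e P(1) by (auto simp: image_image)
qed

lemma spart_has_sum:
  assumes "A \<in> \<SS>" "spart A P"
  shows "(\<mu> has_sum \<mu> A) P" "(\<lambda>p. \<bar>\<mu> p\<bar>) summable_on P"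
proof -
  note P = spartD[OF assms(2)]
  have h: "has_abs_sum (\<lambda>l. \<mu> (from_nat_into P l)) (to_nat_on P ` P) (\<mu> A)"
    using abs_add assms(1) family_of_spart[OF assms(2)] unfolding abs_additive_measure_def by blast
  have i: "inj_on (to_nat_on P) P" using P(4) by (rule inj_on_to_nat_on)
  have e: "from_nat_into P (to_nat_on P p) = p" if "p \<in> P" for p
    using that P(4) by simp
  have "((\<lambda>l. \<mu> (from_nat_into P l)) has_sum \<mu> A) (to_nat_on P ` P)"
    using h by (simp add: has_abs_sum_def)
  then show "(\<mu> has_sum \<mu> A) P"
    using e by (simp add: has_sum_reindex[OF i] o_def cong: has_sum_cong)
  have "(\<lambda>l. \<bar>\<mu> (from_nat_into P l)\<bar>) summable_on (to_nat_on P ` P)"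
    using h by (simp add: has_abs_sum_def)
  then show "(\<lambda>p. \<bar>\<mu> p\<bar>) summable_on P"
    using e by (simp add: summable_on_reindex[OF i] o_def cong: summable_on_cong)
qed

lemma spart_empty: "spart {} {}"
  by (rule spartI) auto

lemma spart_single: "A \<in> \<SS> \<Longrightarrow> A \<noteq> {} \<Longrightarrow> spart A {A}"
  by (rule spartI) auto

lemma ex_spart: "A \<in> \<SS> \<Longrightarrow> \<exists>P. spart A P"
  by (metis spart_empty spart_single)

lemma ex_spart_diff: "A \<in> \<SS> \<Longrightarrow> B \<in> \<SS> \<Longrightarrow> \<exists>P. spart (A - B) P"
  using isys spart_of_family unfolding interval_system_def by metis

lemma ex_spart_int: "A \<in> \<SS> \<Longrightarrow> B \<in> \<SS> \<Longrightarrow> \<exists>P. spart (A \<inter> B) P"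
  using isys spart_of_family unfolding interval_system_def by metis

section \<open>Unions, refinements and differences of partitions\<close>

lemma spart_UN:
  assumes "countable I" "disjoint_family_on U I" "\<And>i. i \<in> I \<Longrightarrow> spart (U i) (g i)"
  shows "spart (\<Union>i\<in>I. U i) (\<Union>i\<in>I. g i)"
proof (rule spartI)
  note D = spartD[OF assms(3)]
  show "\<Union> (\<Union> (g ` I)) = \<Union> (U ` I)" using D(1) by fastforce
  show "{} \<notin> \<Union> (g ` I)" using D(3) by auto
  show "countable (\<Union> (g ` I))" using assms(1) D(4) by auto
  show "\<Union> (g ` I) \<subseteq> \<SS>" using D(5) by auto
  show "disjoint (\<Union> (g ` I))"
  proof (rule disjointI)
    fix a b assume a: "a \<in> \<Union> (g ` I)" and b: "b \<in> \<Union> (g ` I)" and ne: "a \<noteq> b"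
    obtain i j where i: "i \<in> I" "a \<in> g i" and j: "j \<in> I" "b \<in> g j" using a b by auto
    show "a \<inter> b = {}"
    proof (cases "i = j")
      case True
      then show ?thesis using D(2)[OF i(1)] i j ne by (auto simp: disjoint_def)
    next
      case False
      then have "U i \<inter> U j = {}" using assms(2) i j by (auto simp: disjoint_family_on_def)
      moreover have "a \<subseteq> U i" "b \<subseteq> U j" using D(1) i j by auto
      ultimately show ?thesis by auto
    qed
  qed
qed

text \<open>\<open>V\<close> is an arbitrary set, so that taking it to be a member or the complement
  of a member covers both intersection and subtraction.\<close>

lemma spart_refine:
  assumes P: "spart U P" and "\<And>p. p \<in> P \<Longrightarrow> \<exists>G. spart (p \<inter> V) G"
  shows "\<exists>Q. spart (U \<inter> V) Q \<and> (\<forall>q\<in>Q. \<exists>p\<in>P. q \<subseteq> p)"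
proof -
  obtain G where G: "\<And>p. p \<in> P \<Longrightarrow> spart (p \<inter> V) (G p)" using assms(2) by metis
  have d: "disjoint_family_on (\<lambda>p. p \<inter> V) P"
    using spartD(2)[OF P] by (auto simp: disjoint_family_on_def disjoint_def)
  have eq: "(\<Union>p\<in>P. p \<inter> V) = U \<inter> V" using spartD(1)[OF P] by auto
  have "spart (U \<inter> V) (\<Union>p\<in>P. G p)"
    using spart_UN[OF spartD(4)[OF P] d G] unfolding eq .
  moreover have "\<forall>q\<in>(\<Union>p\<in>P. G p). \<exists>p\<in>P. q \<subseteq> p"
  proof
    fix q assume "q \<in> (\<Union>p\<in>P. G p)"
    then obtain p where p: "p \<in> P" "q \<in> G p" by blast
    then show "\<exists>p\<in>P. q \<subseteq> p" using spartD(1)[OF G[OF p(1)]] by blast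
  qed
  ultimately show ?thesis by blast
qed

lemma spart_Diff:
  assumes P: "spart U P" and "B \<in> \<SS>"
  shows "\<exists>Q. spart (U - B) Q \<and> (\<forall>q\<in>Q. \<exists>p\<in>P. q \<subseteq> p)"
proof -
  have "\<exists>G. spart (p \<inter> - B) G" if "p \<in> P" for p
    using ex_spart_diff[OF _ assms(2), of p] spartD(5)[OF P] that by (auto simp: Diff_eq)
  from spart_refine[OF P this] show ?thesis by (simp add: Diff_eq)
qed

lemma spart_Diff_finite:
  assumes "finite F" "F \<subseteq> \<SS>" and P: "spart U P"
  shows "\<exists>Q. spart (U - \<Union>F) Q \<and> (\<forall>q\<in>Q. \<exists>p\<in>P. q \<subseteq> p)"
  using assms(1,2)
proof (induction F rule: finite_induct)
  case empty
  then show ?case using P by auto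
next
  case (insert B F)
  then obtain Q where Q: "spart (U - \<Union>F) Q" "\<forall>q\<in>Q. \<exists>p\<in>P. q \<subseteq> p" by auto
  obtain R where R: "spart (U - \<Union>F - B) R" "\<forall>r\<in>R. \<exists>q\<in>Q. r \<subseteq> q"
    using spart_Diff[OF Q(1), of B] insert.prems by auto
  moreover have "U - \<Union>F - B = U - \<Union>(insert B F)" by auto
  ultimately show ?case using Q(2) by (metis order_trans)
qed

lemma spart_common:
  assumes P: "spart U P" and Q: "spart V Q"
  shows "\<exists>R. spart (U \<inter> V) R \<and> (\<forall>r\<in>R. (\<exists>p\<in>P. r \<subseteq> p) \<and> (\<exists>q\<in>Q. r \<subseteq> q))"
proof -
  have "\<exists>g. spart (p \<inter> V) g \<and> (\<forall>r\<in>g. \<exists>q\<in>Q. r \<subseteq> q)" if p: "p \<in> P" for p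
  proof -
    have "\<exists>G. spart (q \<inter> p) G" if "q \<in> Q" for q
      using that p spartD(5)[OF P] spartD(5)[OF Q] by (blast intro: ex_spart_int)
    from spart_refine[OF Q this] show ?thesis by (auto simp: Int_commute)
  qed
  then obtain g where g: "\<And>p. p \<in> P \<Longrightarrow> spart (p \<inter> V) (g p)" "\<And>p r. p \<in> P \<Longrightarrow> r \<in> g p \<Longrightarrow> \<exists>q\<in>Q. r \<subseteq> q"
    by metis
  have d: "disjoint_family_on (\<lambda>p. p \<inter> V) P"
    using spartD(2)[OF P] by (auto simp: disjoint_family_on_def disjoint_def)
  have "spart (\<Union>p\<in>P. p \<inter> V) (\<Union>p\<in>P. g p)"
    by (rule spart_UN[OF spartD(4)[OF P] d g(1)])
  moreover have "(\<Union>p\<in>P. p \<inter> V) = U \<inter> V" using spartD(1)[OF P] by auto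
  moreover have "(\<exists>p\<in>P. r \<subseteq> p) \<and> (\<exists>q\<in>Q. r \<subseteq> q)" if r: "r \<in> (\<Union>p\<in>P. g p)" for r
  proof -
    obtain p where "p \<in> P" "r \<in> g p" using r by blast
    then show ?thesis using spartD(1)[OF g(1)] g(2) by blast
  qed
  ultimately have "spart (U \<inter> V) (\<Union>p\<in>P. g p)" "\<forall>q\<in>(\<Union>p\<in>P. g p). (\<exists>p\<in>P. q \<subseteq> p) \<and> (\<exists>p\<in>Q. q \<subseteq> p)" by simp_all
  then show ?thesis by blast
qed

text \<open>In an enumeration of the cover, each set minus its finitely many predecessors has a
  partition by \<open>spart_Diff_finite\<close>, and these differences are disjoint.\<close>

lemma spart_of_cover:
  assumes "countable \<Q>" "\<Q> \<subseteq> \<SS>"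
  shows "\<exists>P. spart (\<Union>\<Q>) P \<and> (\<forall>p\<in>P. \<exists>q\<in>\<Q>. p \<subseteq> q)"
proof (cases "\<Q> = {}")
  case True
  then show ?thesis using spart_empty by auto
next
  case False
  define e where "e = from_nat_into \<Q>"
  have r: "range e = \<Q>" using assms(1) False by (simp add: e_def)
  have eS: "e n \<in> \<SS>" for n using r assms(2) by auto
  have "\<exists>g. spart (disjointed e n) g" for n
  proof -
    obtain P where P: "spart (e n) P" using ex_spart[OF eS] by auto
    have "\<exists>Q. spart (e n - \<Union>(e ` {0..<n})) Q \<and> (\<forall>q\<in>Q. \<exists>p\<in>P. q \<subseteq> p)"
      by (rule spart_Diff_finite[OF _ _ P]) (use eS in auto)
    then show ?thesis by (auto simp: disjointed_def)
  qed
  then obtain g where g: "\<And>n. spart (disjointed e n) (g n)" by metis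
  have "spart (\<Union>n. disjointed e n) (\<Union>n. g n)"
    by (rule spart_UN) (use g disjoint_family_disjointed in auto)
  moreover have "(\<Union>n. disjointed e n) = \<Union>\<Q>" using UN_disjointed_eq[of e] r by simp
  moreover have "\<exists>q\<in>\<Q>. p \<subseteq> q" if p: "p \<in> (\<Union>n. g n)" for p
  proof -
    obtain n where "p \<in> g n" using p by blast
    then have "p \<subseteq> e n" using spartD(1)[OF g] disjointed_subset[of e n] by blast
    then show ?thesis using r by blast
  qed
  ultimately show ?thesis by (intro exI[of _ "\<Union>n. g n"]) auto
qed

text \<open>In \<open>\<psi> x P\<close> the point \<open>x\<close> need not lie in \<open>P\<close>. This makes the notion stable under refinement, so
  that disjointifying a cover already produces a partition; the values of a function at such outer
  tags \<open>x\<close> are good enough below, because they only serve as constants in fibres of envelopes.\<close>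

definition pcov :: "'a set \<Rightarrow> ('a \<Rightarrow> 'a set \<Rightarrow> bool) \<Rightarrow> bool" where
  "pcov U \<psi> \<longleftrightarrow> (\<exists>\<Q>. countable \<Q> \<and> \<Q> \<subseteq> \<SS> \<and> \<Union>\<Q> = U \<and>
     (\<forall>x\<in>U. \<exists>Q\<in>\<Q>. x \<in> Q \<and> (\<forall>P. P \<subseteq> Q \<longrightarrow> \<psi> x P)))"

text \<open>Only those members of the cover that serve some point are disjointified. Each resulting
  block lies in such a member and takes over its point as a tag.\<close>

lemma pcov_imp_spart:
  assumes "pcov U \<psi>"
  shows "\<exists>P. spart U P \<and> (\<forall>p\<in>P. \<exists>x\<in>U. \<psi> x p)"
proof -
  obtain \<Q> where Q: "countable \<Q>" "\<Q> \<subseteq> \<SS>" "\<Union>\<Q> = U"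
     "\<And>x. x\<in>U \<Longrightarrow> \<exists>Q\<in>\<Q>. x \<in> Q \<and> (\<forall>P. P \<subseteq> Q \<longrightarrow> \<psi> x P)"
    using assms unfolding pcov_def by metis
  define \<R> where "\<R> = {Q\<in>\<Q>. \<exists>x\<in>U. \<forall>P. P \<subseteq> Q \<longrightarrow> \<psi> x P}"
  have "\<Union>\<R> = U"
  proof
    show "\<Union>\<R> \<subseteq> U" using Q(3) by (auto simp: \<R>_def)
    show "U \<subseteq> \<Union>\<R>" using Q(4) unfolding \<R>_def by blast
  qed
  moreover have "countable \<R>" "\<R> \<subseteq> \<SS>"
    using Q(1,2) by (auto simp: \<R>_def)
  ultimately obtain P where "spart U P" "\<forall>p\<in>P. \<exists>q\<in>\<R>. p \<subseteq> q"
    using spart_of_cover by metis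
  then show ?thesis unfolding \<R>_def by blast
qed

lemma pcov_conj:
  assumes "pcov U \<psi>" "pcov U \<phi>"
  shows "pcov U (\<lambda>x p. \<psi> x p \<and> \<phi> x p)"
proof -
  obtain \<Q> where Q: "countable \<Q>" "\<Q> \<subseteq> \<SS>" "\<Union>\<Q> = U"
     "\<And>x. x\<in>U \<Longrightarrow> \<exists>Q\<in>\<Q>. x \<in> Q \<and> (\<forall>P. P \<subseteq> Q \<longrightarrow> \<psi> x P)"
    using assms(1) unfolding pcov_def by metis
  obtain \<R> where R: "countable \<R>" "\<R> \<subseteq> \<SS>" "\<Union>\<R> = U"
     "\<And>x. x\<in>U \<Longrightarrow> \<exists>Q\<in>\<R>. x \<in> Q \<and> (\<forall>P. P \<subseteq> Q \<longrightarrow> \<phi> x P)"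
    using assms(2) unfolding pcov_def by metis
  have "\<exists>g. spart (q \<inter> r) g" if "q \<in> \<Q>" "r \<in> \<R>" for q r
    using ex_spart_int that Q(2) R(2) by blast
  then obtain g where g: "\<And>q r. q \<in> \<Q> \<Longrightarrow> r \<in> \<R> \<Longrightarrow> spart (q \<inter> r) (g q r)" by metis
  note G = spartD[OF g]
  let ?T = "\<Union>q\<in>\<Q>. \<Union>r\<in>\<R>. g q r"
  have *: "\<exists>T\<in>?T. x \<in> T \<and> (\<forall>P. P \<subseteq> T \<longrightarrow> \<psi> x P \<and> \<phi> x P)" if x: "x \<in> U" for x
  proof -
    obtain q where q: "q \<in> \<Q>" "x \<in> q" "\<forall>P. P \<subseteq> q \<longrightarrow> \<psi> x P" using Q(4)[OF x] by auto
    obtain r where r: "r \<in> \<R>" "x \<in> r" "\<forall>P. P \<subseteq> r \<longrightarrow> \<phi> x P" using R(4)[OF x] by auto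
    have "x \<in> \<Union>(g q r)" using G(1)[OF q(1) r(1)] q r by auto
    then obtain T where T: "T \<in> g q r" "x \<in> T" by auto
    have "T \<subseteq> q \<inter> r" using T(1) G(1)[OF q(1) r(1)] by auto
    then show ?thesis using T q r by (intro bexI[of _ T]) auto
  qed
  moreover have "countable ?T" using Q(1) R(1) G(4) by auto
  moreover have "?T \<subseteq> \<SS>" using G(5) by blast
  moreover have "\<Union>?T = U"
  proof
    show "\<Union>?T \<subseteq> U" using G(1) Q(3) R(3) by blast
    show "U \<subseteq> \<Union>?T" using * by blast
  qed
  ultimately show ?thesis unfolding pcov_def by (intro exI[of _ ?T]) blast
qed

lemma pcov_mono:
  assumes "pcov U \<psi>" "\<And>x P. x \<in> U \<Longrightarrow> \<psi> x P \<Longrightarrow> \<phi> x P"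
  shows "pcov U \<phi>"
proof -
  obtain \<Q> where Q: "countable \<Q>" "\<Q> \<subseteq> \<SS>" "\<Union>\<Q> = U"
     "\<forall>x\<in>U. \<exists>Q\<in>\<Q>. x \<in> Q \<and> (\<forall>P. P \<subseteq> Q \<longrightarrow> \<psi> x P)"
    using assms(1) unfolding pcov_def by auto
  then have "\<forall>x\<in>U. \<exists>Q\<in>\<Q>. x \<in> Q \<and> (\<forall>P. P \<subseteq> Q \<longrightarrow> \<phi> x P)"
    using assms(2) by meson
  with Q(1-3) show ?thesis unfolding pcov_def by blast
qed

lemma pcov_spart:
  assumes "spart U P"
  shows "pcov U (\<lambda>x p. \<exists>q\<in>P. p \<subseteq> q)"
  unfolding pcov_def using spartD[OF assms] by (intro exI[of _ P]) blast

text \<open>Adapted sets lie in a single atom of the family, so step functions built from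
  \<open>\<E>\<close> are constant on them.\<close>

definition adapted :: "'a set set \<Rightarrow> 'a set \<Rightarrow> bool" where
  "adapted \<E> p \<longleftrightarrow> (\<forall>e\<in>\<E>. p \<subseteq> e \<or> p \<inter> e = {})"

text \<open>The point \<open>x\<close> is included in the adapted set because
  \<open>pcov_envelope\<close> carries a value of a step function from \<open>x\<close> to
  \<open>p\<close>, and \<open>x\<close> may lie outside \<open>p\<close>. The induction splits
  \<open>U\<close> along one more set \<open>e\<close> into partitions of its parts inside and
  outside \<open>e\<close>.\<close>

lemma pcov_adapted:
  assumes "finite \<E>" "\<E> \<subseteq> \<SS>" and P: "spart U P"
  shows "pcov U (\<lambda>x p. adapted \<E> (insert x p))"
  using assms(1,2)
proof (induction \<E> rule: finite_induct)
  case empty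
  show ?case by (rule pcov_mono[OF pcov_spart[OF P]]) (auto simp: adapted_def)
next
  case (insert e \<E>)
  obtain A where A: "spart (U - e) A" using spart_Diff[OF P, of e] insert.prems by auto
  have "\<exists>G. spart (p \<inter> e) G" if "p \<in> P" for p
    using that insert.prems spartD(5)[OF P] by (blast intro: ex_spart_int)
  then obtain B where B: "spart (U \<inter> e) B" using spart_refine[OF P, of e] by auto
  note A' = spartD[OF A] and B' = spartD[OF B]
  have *: "\<exists>Q\<in>A \<union> B. x \<in> Q \<and> (\<forall>p. p \<subseteq> Q \<longrightarrow> adapted {e} (insert x p))" if xU: "x \<in> U" for x
  proof (cases "x \<in> e")
    case True
    then obtain Q where "Q \<in> B" "x \<in> Q" using B'(1) xU by blast
    moreover have "Q \<subseteq> e" using \<open>Q \<in> B\<close> B'(1) by auto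
    ultimately show ?thesis by (auto simp: adapted_def)
  next
    case False
    then obtain Q where "Q \<in> A" "x \<in> Q" using A'(1) xU by blast
    moreover have "Q \<inter> e = {}" using \<open>Q \<in> A\<close> A'(1) by auto
    ultimately show ?thesis by (intro bexI[of _ Q]) (auto simp: adapted_def)
  qed
  have "pcov U (\<lambda>x p. adapted {e} (insert x p))"
    unfolding pcov_def using A' B' * by (intro exI[of _ "A \<union> B"]) auto
  from pcov_conj[OF this insert.IH] insert.prems show ?case
    by (rule_tac pcov_mono) (auto simp: adapted_def)
qed

lemma adapted_mono: "adapted \<E> p \<Longrightarrow> q \<subseteq> p \<Longrightarrow> adapted \<E> q"
  unfolding adapted_def by blast

end

section \<open>Step functions and oscillation of envelopes\<close>

text \<open>This is the passage from finite subfamilies of countable partitions to the full sums: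
  each of the finitely many sums is approximated within an equal share of the error.\<close>

lemma has_sum_sum_le:
  fixes g :: "'k \<Rightarrow> 'i \<Rightarrow> real"
  assumes "finite K" "\<And>k. k \<in> K \<Longrightarrow> (g k has_sum a k) (P k)"
    and le: "\<And>H. (\<And>k. k \<in> K \<Longrightarrow> finite (H k) \<and> H k \<subseteq> P k) \<Longrightarrow> (\<Sum>k\<in>K. \<bar>\<Sum>q\<in>H k. g k q\<bar>) \<le> d"
  shows "(\<Sum>k\<in>K. \<bar>a k\<bar>) \<le> d"
proof (rule field_le_epsilon)
  fix e :: real assume e: "e > 0"
  define e' where "e' = e / (card K + 1)"
  have e': "e' > 0" using e by (simp add: e'_def)
  have "\<forall>k\<in>K. \<exists>F. finite F \<and> F \<subseteq> P k \<and> dist (sum (g k) F) (a k) \<le> e'"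
    using has_sum_finite_approximation[OF assms(2) e'] by blast
  then obtain H where H: "\<And>k. k \<in> K \<Longrightarrow> finite (H k) \<and> H k \<subseteq> P k"
      "\<And>k. k \<in> K \<Longrightarrow> dist (sum (g k) (H k)) (a k) \<le> e'"
    by metis
  have "(\<Sum>k\<in>K. \<bar>a k\<bar>) \<le> (\<Sum>k\<in>K. \<bar>\<Sum>q\<in>H k. g k q\<bar> + e')"
    using H(2) by (intro sum_mono) (force simp: dist_real_def)
  also have "\<dots> = (\<Sum>k\<in>K. \<bar>\<Sum>q\<in>H k. g k q\<bar>) + card K * e'"
    by (simp add: sum.distrib)
  also have "card K * e' \<le> e"
    using e by (simp add: e'_def field_simps)
  finally show "(\<Sum>k\<in>K. \<bar>a k\<bar>) \<le> d + e" using le[OF H(1)] by linarith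
qed

lemma has_sum_abs_le:
  fixes g :: "'i \<Rightarrow> real"
  assumes "(g has_sum a) P" "\<And>H. finite H \<Longrightarrow> H \<subseteq> P \<Longrightarrow> \<bar>\<Sum>q\<in>H. g q\<bar> \<le> d"
  shows "\<bar>a\<bar> \<le> d"
proof -
  have "(\<Sum>k\<in>{()}. \<bar>a\<bar>) \<le> d"
  proof (rule has_sum_sum_le)
    show "(g has_sum a) P" by fact
    fix H assume "\<And>k::unit. k \<in> {()} \<Longrightarrow> finite (H k) \<and> H k \<subseteq> P"
    then show "(\<Sum>k\<in>{()}. \<bar>\<Sum>q\<in>H k. g q\<bar>) \<le> d" using assms(2)[of "H ()"] by simp
  qed simp
  then show ?thesis by simp
qed

lemma has_sum_finite_sum:
  fixes g :: "'k \<Rightarrow> 'i \<Rightarrow> real"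
  assumes "\<And>k. k \<in> K \<Longrightarrow> (g k has_sum a k) P"
  shows "((\<lambda>i. \<Sum>k\<in>K. g k i) has_sum (\<Sum>k\<in>K. a k)) P"
proof -
  have "((\<lambda>F. \<Sum>k\<in>K. sum (g k) F) \<longlongrightarrow> (\<Sum>k\<in>K. a k)) (finite_subsets_at_top P)"
    using assms by (intro tendsto_sum) (auto simp: has_sum_def)
  moreover have "(\<Sum>k\<in>K. sum (g k) F) = (\<Sum>i\<in>F. \<Sum>k\<in>K. g k i)" for F by (rule sum.swap)
  ultimately show ?thesis by (simp only: has_sum_def)
qed

lemma sum_indicator_disjoint:
  fixes c :: "'i \<Rightarrow> real"
  assumes "finite I" "disjoint_family_on A I" "i \<in> I" "x \<in> A i"
  shows "(\<Sum>j\<in>I. c j * indicator (A j) x) = c i"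
proof -
  have "(\<Sum>j\<in>I. c j * indicator (A j) x) = (\<Sum>j\<in>{i}. c j * indicator (A j) x)"
    using assms by (intro sum.mono_neutral_right) (auto simp: disjoint_family_on_def indicator_def)
  then show ?thesis using assms(4) by simp
qed

lemma mem_const_fibre_mono: "v \<in> const_fibre \<A> q \<Longrightarrow> p \<subseteq> q \<Longrightarrow> v \<in> const_fibre \<A> p"
  by (auto simp: const_fibre_def)

lemma sum_fst_Sigma:
  assumes "finite K" "\<And>k. k \<in> K \<Longrightarrow> finite (H k)"
  shows "(\<Sum>k\<in>K. \<Sum>q\<in>H k. g k q) = (\<Sum>i\<in>Sigma K H. g (fst i) (snd i))"
proof -
  have "(\<Sum>k\<in>K. \<Sum>q\<in>H k. g k q) = (\<Sum>(k, q)\<in>Sigma K H. g k q)"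
    by (rule sum.Sigma) (use assms in blast)+
  then show ?thesis by (simp only: case_prod_unfold)
qed

lemma bounded_abs_sums_summable:
  fixes g :: "'i \<Rightarrow> real"
  assumes "\<And>H. finite H \<Longrightarrow> H \<subseteq> P \<Longrightarrow> (\<Sum>i\<in>H. \<bar>g i\<bar>) \<le> d"
  shows "g summable_on P"
proof (rule iffD2[OF summable_on_iff_abs_summable_on_real nonneg_bdd_above_summable_on])
  show "bdd_above (sum (\<lambda>i. norm (g i)) ` {F. F \<subseteq> P \<and> finite F})"
    by (rule bdd_aboveI2[where M = d]) (simp add: assms)
qed simp

context interval_measure
begin

text \<open>A relation, since \<open>r\<close> and \<open>\<E>\<close> are read off from one
  representation of \<open>s\<close>. Independence of the representation does not have to be settled
  beforehand.\<close>

definition stepr :: "('a \<Rightarrow> real) \<Rightarrow> real \<Rightarrow> 'a set set \<Rightarrow> bool" where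
  "stepr s r \<E> \<longleftrightarrow> (\<exists>J c E. finite J \<and> (\<forall>j\<in>J. E j \<in> \<SS>) \<and> s = step_sum J c E \<and>
     r = (\<Sum>j\<in>J. c j * \<mu> (E j)) \<and> \<E> = E ` J)"

definition raw_integral :: "(real \<times> 'a) set \<Rightarrow> real \<Rightarrow> bool" where
  "raw_integral \<A> r \<longleftrightarrow> (\<exists>s \<E>. stepr s r \<E> \<and> graph_on X s \<subseteq> \<A>)"

text \<open>A bound on the diameter of the integral of the envelope. It is stated before taking
  closures because step functions can be modified there; \<open>osc_le_closure\<close> carries it
  over.\<close>

definition osc_le :: "(real \<times> 'a) set \<Rightarrow> real \<Rightarrow> bool" where
  "osc_le \<A> d \<longleftrightarrow> (\<forall>r r'. raw_integral \<A> r \<longrightarrow> raw_integral \<A> r' \<longrightarrow> \<bar>r - r'\<bar> \<le> d)"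

text \<open>Meaningful only if \<open>p\<close> is nonempty and \<open>s\<close> is constant on \<open>p\<close>.\<close>

definition val :: "('a \<Rightarrow> real) \<Rightarrow> 'a set \<Rightarrow> real" where
  "val s p = s (SOME x. x \<in> p)"

section \<open>Elementary integrals of step functions\<close>

lemma stepr_sets: "stepr s r \<E> \<Longrightarrow> finite \<E>" "stepr s r \<E> \<Longrightarrow> \<E> \<subseteq> \<SS>"
  by (auto simp: stepr_def)

lemma stepr_const:
  assumes "stepr s r \<E>" "adapted \<E> p" "x \<in> p" "y \<in> p"
  shows "s x = s y"
proof -
  obtain J c E where s: "s = step_sum J c E" "\<E> = E ` J" using assms(1) by (auto simp: stepr_def)
  have "indicat_real (E j) x = indicator (E j) y" if "j \<in> J" for j
    using assms(2-4) s(2) that unfolding adapted_def indicator_def by auto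
  then show ?thesis by (simp add: s(1) step_sum_def)
qed

lemma val_eq:
  assumes "stepr s r \<E>" "adapted \<E> p" "x \<in> p"
  shows "val s p = s x"
  unfolding val_def using stepr_const[OF assms(1,2) someI[of "\<lambda>x. x \<in> p", OF assms(3)] assms(3)] .

lemma stepr_bounded:
  assumes "stepr s r \<E>"
  shows "\<exists>M\<ge>0. \<forall>x. \<bar>s x\<bar> \<le> M"
proof -
  obtain J c E where s: "s = step_sum J c E" using assms by (auto simp: stepr_def)
  have "\<bar>s x\<bar> \<le> (\<Sum>j\<in>J. \<bar>c j\<bar>)" for x
    unfolding s step_sum_def
    by (rule order_trans[OF sum_abs]) (auto intro!: sum_mono simp: indicator_def)
  then show ?thesis by (meson abs_ge_zero order_trans)
qed

lemma stepr_insert: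
  assumes "stepr s r \<E>" "p \<in> \<SS>"
  shows "stepr (\<lambda>x. s x + c * indicator p x) (r + c * \<mu> p) (insert p \<E>)"
proof -
  obtain J d E where J: "finite J" "\<forall>j\<in>J. E j \<in> \<SS>" "s = step_sum J d E"
     "r = (\<Sum>j\<in>J. d j * \<mu> (E j))" "\<E> = E ` J" using assms by (auto simp: stepr_def)
  obtain n :: nat where n: "n \<notin> J" using J(1) ex_new_if_finite infinite_UNIV_nat by blast
  have ne: "j \<noteq> n" if "j \<in> J" for j using n that by auto
  show ?thesis unfolding stepr_def
  proof (intro exI[of _ "insert n J"] exI[of _ "d(n:=c)"] exI[of _ "E(n:=p)"] conjI)
    show "(\<lambda>x. s x + c * indicator p x) = step_sum (insert n J) (d(n := c)) (E(n := p))"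
    proof
      fix x
      have "(\<Sum>j\<in>J. (d(n := c)) j * indicator ((E(n := p)) j) x) = (\<Sum>j\<in>J. d j * indicator (E j) x)"
        using ne by (intro sum.cong) auto
      then show "s x + c * indicator p x = step_sum (insert n J) (d(n := c)) (E(n := p)) x"
        using J(1) n by (simp add: J(3) step_sum_def del: sum_mult_indicator)
    qed
    show "r + c * \<mu> p = (\<Sum>j\<in>insert n J. (d(n := c)) j * \<mu> ((E(n := p)) j))"
      using J(1) n ne by (auto simp: J(4) intro!: sum.cong)
    show "insert p \<E> = (E(n := p)) ` insert n J" using n ne by (auto simp: J(5))
  qed (use J assms(2) in auto)
qed

lemma stepr_zero: "stepr (\<lambda>x. 0) 0 {}"
  unfolding stepr_def by (intro exI[of _ "{}"]) (auto simp: step_sum_def fun_eq_iff)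

lemma stepr_add:
  assumes "finite I" "stepr s r \<E>" "\<And>i. i \<in> I \<Longrightarrow> A i \<in> \<SS>"
  shows "stepr (\<lambda>x. s x + (\<Sum>i\<in>I. c i * indicator (A i) x)) (r + (\<Sum>i\<in>I. c i * \<mu> (A i))) (A ` I \<union> \<E>)"
  using assms(1,3)
proof (induction I rule: finite_induct)
  case empty
  then show ?case using assms(2) by simp
next
  case (insert i I)
  have "stepr (\<lambda>x. s x + (\<Sum>i\<in>I. c i * indicator (A i) x)) (r + (\<Sum>i\<in>I. c i * \<mu> (A i))) (A ` I \<union> \<E>)"
    using insert by simp
  from stepr_insert[OF this, of "A i" "c i"] insert show ?case
    by (simp add: add_ac del: sum_mult_indicator)
qed

text \<open>Each \<open>E j\<close> is the disjoint union of the blocks that it contains, so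
  absolute additivity expands \<open>\<mu> (E j)\<close> over \<open>P\<close>. On a block,
  \<open>s\<close> is the sum of the coefficients of those \<open>E j\<close> that contain the
  block.\<close>

lemma stepr_has_sum:
  assumes s: "stepr s r \<E>" and P: "spart U P" "\<Union>\<E> \<subseteq> U" "\<And>p. p \<in> P \<Longrightarrow> adapted \<E> p"
  shows "((\<lambda>p. val s p * \<mu> p) has_sum r) P"
proof -
  note D = spartD[OF P(1)]
  obtain J d E where J: "finite J" "\<forall>j\<in>J. E j \<in> \<SS>" "s = step_sum J d E"
     "r = (\<Sum>j\<in>J. d j * \<mu> (E j))" "\<E> = E ` J" using s by (auto simp: stepr_def)
  have "((\<lambda>p. d j * ((if p \<subseteq> E j then 1 else 0) * \<mu> p)) has_sum d j * \<mu> (E j)) P" if j: "j \<in> J" for j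
  proof (rule has_sum_cmult_right)
    have "spart (E j) {p\<in>P. p \<subseteq> E j}"
    proof (rule spartI)
      have "\<exists>p\<in>P. p \<subseteq> E j \<and> x \<in> p" if x: "x \<in> E j" for x
      proof -
        obtain p where p: "p \<in> P" "x \<in> p" using D(1) P(2) J(5) j x by blast
        then show ?thesis using P(3)[OF p(1)] x j J(5) unfolding adapted_def by blast
      qed
      then show "\<Union> {p \<in> P. p \<subseteq> E j} = E j" by blast
      show "disjoint {p \<in> P. p \<subseteq> E j}" using D(2) by (auto simp: disjoint_def)
      show "countable {p \<in> P. p \<subseteq> E j}" using D(4) by (rule countable_subset[rotated]) auto
    qed (use D in auto)
    then have "(\<mu> has_sum \<mu> (E j)) {p\<in>P. p \<subseteq> E j}" using spart_has_sum(1) J(2) j by blast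
    then show "((\<lambda>p. (if p \<subseteq> E j then 1 else 0) * \<mu> p) has_sum \<mu> (E j)) P"
      by (subst has_sum_cong_neutral[where T = "{p\<in>P. p \<subseteq> E j}" and g = \<mu>]) auto
  qed
  then have *: "((\<lambda>p. \<Sum>j\<in>J. d j * ((if p \<subseteq> E j then 1 else 0) * \<mu> p)) has_sum r) P"
    unfolding J(4) by (rule has_sum_finite_sum)
  have "val s p * \<mu> p = (\<Sum>j\<in>J. d j * ((if p \<subseteq> E j then 1 else 0) * \<mu> p))" if p: "p \<in> P" for p
  proof -
    obtain x where x: "x \<in> p" using D(3) p by fastforce
    have i: "indicat_real (E j) x = (if p \<subseteq> E j then 1 else 0)" if "j \<in> J" for j
      using P(3)[OF p] x that J(5) unfolding adapted_def indicator_def by auto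
    show ?thesis
      unfolding val_eq[OF s P(3)[OF p] x] unfolding J(3) step_sum_def sum_distrib_right
      using i by (intro sum.cong) simp_all
  qed
  with * show ?thesis by (simp cong: has_sum_cong)
qed

section \<open>Modifying step functions inside an envelope\<close>

lemma env_integral_eq: "env_integral X \<SS> \<mu> \<A> = closure {r. raw_integral \<A> r}"
  unfolding env_integral_def raw_integral_def stepr_def
  by (rule arg_cong[where f = closure]) blast

lemma envelope_raw:
  assumes "envelope X \<SS> \<A>"
  obtains s r \<E> where "stepr s r \<E>" "graph_on X s \<subseteq> \<A>"
proof -
  from assms obtain s where "step_function \<SS> s" and s: "graph_on X s \<subseteq> \<A>"
    unfolding envelope_def by auto
  then obtain J c E where "finite J" "\<forall>j\<in>J. E j \<in> \<SS>" "s = step_sum J c E"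
    unfolding step_function_def by auto
  then have "stepr s (\<Sum>j\<in>J. c j * \<mu> (E j)) (E ` J)" unfolding stepr_def by auto
  then show thesis using s that by blast
qed

lemma osc_le_closure:
  assumes "osc_le \<A> d" "r \<in> env_integral X \<SS> \<mu> \<A>" "r' \<in> env_integral X \<SS> \<mu> \<A>"
  shows "\<bar>r - r'\<bar> \<le> d"
proof -
  let ?R = "{r. raw_integral \<A> r}"
  have c: "closed {x. \<bar>x - t\<bar> \<le> d}" for t :: real
    by (intro closed_Collect_le continuous_intros)
  have 1: "\<bar>r - t\<bar> \<le> d" if "raw_integral \<A> t" for t
    using closure_minimal[OF _ c[of t], of ?R] that assms(1,2) unfolding env_integral_eq osc_le_def
    by blast
  have "\<bar>r' - r\<bar> \<le> d"
    using closure_minimal[OF _ c[of r], of ?R] 1 assms(3) unfolding env_integral_eq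
    by (force simp: abs_minus_commute)
  then show ?thesis by (simp add: abs_minus_commute)
qed

text \<open>Since \<open>s\<close> is constant on each \<open>A i\<close>, adding a multiple of one
  indicator replaces its value there by \<open>w i\<close>. The new graph stays in the envelope
  because \<open>w i\<close> lies in the fibre.\<close>

lemma patch:
  assumes s: "stepr s r \<E>" "graph_on X s \<subseteq> \<A>"
    and I: "finite I" "disjoint_family_on A I"
    and A: "\<And>i. i \<in> I \<Longrightarrow> A i \<in> \<SS>" "\<And>i. i \<in> I \<Longrightarrow> adapted \<E> (A i)"
    and w: "\<And>i. i \<in> I \<Longrightarrow> w i \<in> const_fibre \<A> (A i)"
  shows "raw_integral \<A> (r + (\<Sum>i\<in>I. (w i - val s (A i)) * \<mu> (A i)))"
proof -
  let ?t = "\<lambda>x. s x + (\<Sum>i\<in>I. (w i - val s (A i)) * indicator (A i) x)"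
  have "stepr ?t (r + (\<Sum>i\<in>I. (w i - val s (A i)) * \<mu> (A i))) (A ` I \<union> \<E>)"
    by (rule stepr_add[OF I(1) s(1) A(1)])
  moreover have "(?t x, x) \<in> \<A>" if x: "x \<in> X" for x
  proof (cases "\<exists>i\<in>I. x \<in> A i")
    case True
    then obtain i where i: "i \<in> I" "x \<in> A i" by auto
    have "?t x = w i"
      using sum_indicator_disjoint[OF I i] val_eq[OF s(1) A(2)[OF i(1)] i(2)] by simp
    then show ?thesis using w[OF i(1)] i(2) by (auto simp: const_fibre_def)
  next
    case False
    then have "?t x = s x" by (auto intro!: sum.neutral simp: indicator_def)
    then show ?thesis using s(2) x by (auto simp: graph_on_def)
  qed
  then have "graph_on X ?t \<subseteq> \<A>" by (auto simp: graph_on_def)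
  ultimately show ?thesis unfolding raw_integral_def by blast
qed

text \<open>On each set, give the value with the larger contribution to one patched step function
  and the other value to a second one. The difference of the two integrals is then the sum of the
  absolute values.\<close>

lemma osc_bound_adapted:
  assumes s: "stepr s r \<E>" "graph_on X s \<subseteq> \<A>" and osc: "osc_le \<A> d"
    and I: "finite I" "disjoint_family_on A I"
    and A: "\<And>i. i \<in> I \<Longrightarrow> A i \<in> \<SS>" "\<And>i. i \<in> I \<Longrightarrow> adapted \<E> (A i)"
    and w: "\<And>i. i \<in> I \<Longrightarrow> w i \<in> const_fibre \<A> (A i)" "\<And>i. i \<in> I \<Longrightarrow> w' i \<in> const_fibre \<A> (A i)"
  shows "(\<Sum>i\<in>I. \<bar>(w i - w' i) * \<mu> (A i)\<bar>) \<le> d"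
proof -
  define z where "z i = (if (w i - w' i) * \<mu> (A i) \<ge> 0 then w i else w' i)" for i
  define z' where "z' i = (if (w i - w' i) * \<mu> (A i) \<ge> 0 then w' i else w i)" for i
  have "raw_integral \<A> (r + (\<Sum>i\<in>I. (z i - val s (A i)) * \<mu> (A i)))"
    by (rule patch[OF s I A]) (use w in \<open>auto simp: z_def\<close>)
  moreover have "raw_integral \<A> (r + (\<Sum>i\<in>I. (z' i - val s (A i)) * \<mu> (A i)))"
    by (rule patch[OF s I A]) (use w in \<open>auto simp: z'_def\<close>)
  ultimately have "\<bar>(r + (\<Sum>i\<in>I. (z i - val s (A i)) * \<mu> (A i))) - (r + (\<Sum>i\<in>I. (z' i - val s (A i)) * \<mu> (A i)))\<bar> \<le> d"
    using osc unfolding osc_le_def by blast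
  moreover have "(r + (\<Sum>i\<in>I. (z i - val s (A i)) * \<mu> (A i))) - (r + (\<Sum>i\<in>I. (z' i - val s (A i)) * \<mu> (A i)))
      = (\<Sum>i\<in>I. (z i - z' i) * \<mu> (A i))"
    by (simp add: algebra_simps flip: sum_subtractf)
  moreover have "(\<Sum>i\<in>I. (z i - z' i) * \<mu> (A i)) = (\<Sum>i\<in>I. \<bar>(w i - w' i) * \<mu> (A i)\<bar>)"
    by (intro sum.cong refl) (auto simp: z_def z'_def algebra_simps)
  ultimately show ?thesis by simp
qed

lemma ex_adapted_spart:
  assumes "finite \<E>" "\<E> \<subseteq> \<SS>" "spart U P"
  shows "\<exists>Q. spart U Q \<and> (\<forall>q\<in>Q. adapted \<E> q \<and> (\<exists>p\<in>P. q \<subseteq> p))"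
proof -
  have "pcov U (\<lambda>x p. adapted \<E> (insert x p) \<and> (\<exists>q\<in>P. p \<subseteq> q))"
    by (intro pcov_conj pcov_adapted[OF assms] pcov_spart[OF assms(3)])
  from pcov_imp_spart[OF this] obtain Q where
    Q: "spart U Q" "\<forall>q\<in>Q. \<exists>x\<in>U. adapted \<E> (insert x q) \<and> (\<exists>p\<in>P. q \<subseteq> p)" by auto
  have "adapted \<E> q \<and> (\<exists>p\<in>P. q \<subseteq> p)" if q: "q \<in> Q" for q
  proof -
    obtain x where "adapted \<E> (insert x q)" "\<exists>p\<in>P. q \<subseteq> p" using Q(2) q by auto
    then show ?thesis using adapted_mono[of \<E> "insert x q" q] by auto
  qed
  then show ?thesis using Q(1) by auto
qed

lemma disjoint_family_Sigma:
  assumes "disjoint_family_on A K" "\<And>k. k \<in> K \<Longrightarrow> spart (A k) (P k)"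
    "\<And>k. k \<in> K \<Longrightarrow> H k \<subseteq> P k"
  shows "disjoint_family_on snd (Sigma K H)"
  unfolding disjoint_family_on_def
proof (intro ballI impI)
  fix i j assume i: "i \<in> Sigma K H" and j: "j \<in> Sigma K H" and ne: "i \<noteq> j"
  have i': "fst i \<in> K" "snd i \<in> P (fst i)" and j': "fst j \<in> K" "snd j \<in> P (fst j)"
    using i j assms(3) by (auto simp: subset_iff)
  show "snd i \<inter> snd j = {}"
  proof (cases "fst i = fst j")
    case True
    then have "snd i \<noteq> snd j" using ne by (auto simp: prod_eq_iff)
    then show ?thesis using disjointD[OF spartD(2)[OF assms(2)[OF i'(1)]]] i' j' True by metis
  next
    case False
    then have "A (fst i) \<inter> A (fst j) = {}" using assms(1) i' j' by (auto simp: disjoint_family_on_def)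
    moreover have "snd i \<subseteq> A (fst i)" "snd j \<subseteq> A (fst j)"
      using spartD(1)[OF assms(2)] i' j' by blast+
    ultimately show ?thesis by blast
  qed
qed

text \<open>Adaptedness is removed by splitting each \<open>A i\<close> into adapted blocks, which
  keep the values \<open>w i\<close> and \<open>w' i\<close>. The previous bound applies to every
  finite choice of blocks.\<close>

lemma osc_bound:
  assumes env: "envelope X \<SS> \<A>" and osc: "osc_le \<A> d"
    and I: "finite I" "disjoint_family_on A I" and A: "\<And>i. i \<in> I \<Longrightarrow> A i \<in> \<SS>"
    and w: "\<And>i. i \<in> I \<Longrightarrow> w i \<in> const_fibre \<A> (A i)" "\<And>i. i \<in> I \<Longrightarrow> w' i \<in> const_fibre \<A> (A i)"
  shows "(\<Sum>i\<in>I. \<bar>(w i - w' i) * \<mu> (A i)\<bar>) \<le> d"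
proof -
  obtain s r \<E> where s: "stepr s r \<E>" "graph_on X s \<subseteq> \<A>" using envelope_raw[OF env] .
  have "\<exists>Q. spart (A i) Q \<and> (\<forall>q\<in>Q. adapted \<E> q)" if "i \<in> I" for i
    using ex_spart[OF A[OF that]] ex_adapted_spart[OF stepr_sets[OF s(1)]] by meson
  then obtain P where P: "\<And>i. i \<in> I \<Longrightarrow> spart (A i) (P i)" "\<And>i q. i \<in> I \<Longrightarrow> q \<in> P i \<Longrightarrow> adapted \<E> q"
    by metis
  show ?thesis
  proof (rule has_sum_sum_le[OF I(1)])
    show "((\<lambda>q. (w i - w' i) * \<mu> q) has_sum (w i - w' i) * \<mu> (A i)) (P i)" if "i \<in> I" for i
      using spart_has_sum(1)[OF A[OF that] P(1)[OF that]] by (rule has_sum_cmult_right)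
    fix H assume H: "\<And>i. i \<in> I \<Longrightarrow> finite (H i) \<and> H i \<subseteq> P i"
    have "(\<Sum>i\<in>I. \<bar>\<Sum>q\<in>H i. (w i - w' i) * \<mu> q\<bar>) \<le> (\<Sum>i\<in>I. \<Sum>q\<in>H i. \<bar>(w i - w' i) * \<mu> q\<bar>)"
      by (intro sum_mono sum_abs)
    also have "\<dots> = (\<Sum>k\<in>Sigma I H. \<bar>(w (fst k) - w' (fst k)) * \<mu> (snd k)\<bar>)"
      using sum_fst_Sigma[OF I(1), of H "\<lambda>i q. \<bar>(w i - w' i) * \<mu> q\<bar>"] H by simp
    also have "\<dots> \<le> d"
    proof (rule osc_bound_adapted[OF s osc])
      show "disjoint_family_on snd (Sigma I H)"
        by (rule disjoint_family_Sigma[OF I(2) P(1)]) (use H in auto)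
      show "finite (Sigma I H)" using I(1) H by auto
      fix k assume k: "k \<in> Sigma I H"
      then have k': "fst k \<in> I" "snd k \<in> P (fst k)" using H by (auto simp: subset_iff)
      have sub: "snd k \<subseteq> A (fst k)" using spartD(1)[OF P(1)[OF k'(1)]] k'(2) by blast
      show "snd k \<in> \<SS>" using spartD(5)[OF P(1)] k' by blast
      show "adapted \<E> (snd k)" using P(2) k' by blast
      show "w (fst k) \<in> const_fibre \<A> (snd k)" "w' (fst k) \<in> const_fibre \<A> (snd k)"
        using mem_const_fibre_mono[OF w(1) sub] mem_const_fibre_mono[OF w(2) sub] k' by auto
    qed
    finally show "(\<Sum>i\<in>I. \<bar>\<Sum>q\<in>H i. (w i - w' i) * \<mu> q\<bar>) \<le> d" .
  qed
qed

lemma spart_disjoint_family: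
  "spart U P \<Longrightarrow> disjoint_family_on (\<lambda>p. p) P"
  using spartD(2) by (auto simp: disjoint_def disjoint_family_on_def)

text \<open>The differences from the series of \<open>s\<close> are absolutely summable by the
  oscillation bound. Patching \<open>s\<close> on finitely many blocks gives values of step
  functions in the envelope; these converge to the full sum, which belongs to the integral because
  that is closed.\<close>

lemma riemann_sum:
  assumes s: "stepr s r \<E>" "graph_on X s \<subseteq> \<A>" and osc: "osc_le \<A> d"
    and P: "spart U P" "\<Union>\<E> \<subseteq> U" "\<And>p. p \<in> P \<Longrightarrow> adapted \<E> p"
    and u: "\<And>p. p \<in> P \<Longrightarrow> u p \<in> const_fibre \<A> p"
  shows "\<exists>t\<in>env_integral X \<SS> \<mu> \<A>. ((\<lambda>p. u p * \<mu> p) has_sum t) P"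
proof -
  note D = spartD[OF P(1)]
  have sv: "val s p \<in> const_fibre \<A> p" if p: "p \<in> P" for p
    using val_eq[OF s(1) P(3)[OF p]] s(2) sub_X[of p] D(5) p by (auto simp: const_fibre_def graph_on_def)
  have disj: "disjoint_family_on (\<lambda>p. p) H" if "H \<subseteq> P" for H
    using spart_disjoint_family[OF P(1)] that by (auto simp: disjoint_family_on_def)
  have b: "(\<Sum>p\<in>H. \<bar>(u p - val s p) * \<mu> p\<bar>) \<le> d" if "finite H" "H \<subseteq> P" for H
    by (rule osc_bound_adapted[OF s osc that(1) disj[OF that(2)]])
      (use that(2) D(5) P(3) u sv in auto)
  then have "(\<lambda>p. (u p - val s p) * \<mu> p) summable_on P" by (rule bounded_abs_sums_summable)
  then obtain t where t: "((\<lambda>p. (u p - val s p) * \<mu> p) has_sum t) P" by (auto simp: summable_on_def)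
  have "((\<lambda>p. val s p * \<mu> p + (u p - val s p) * \<mu> p) has_sum (r + t)) P"
    by (intro has_sum_add t stepr_has_sum[OF s(1) P])
  then have 1: "((\<lambda>p. u p * \<mu> p) has_sum (r + t)) P" by (simp add: algebra_simps)
  have "((\<lambda>H. r + (\<Sum>p\<in>H. (u p - val s p) * \<mu> p)) \<longlongrightarrow> r + t) (finite_subsets_at_top P)"
    using t by (intro tendsto_intros) (auto simp: has_sum_def)
  moreover have "\<forall>\<^sub>F H in finite_subsets_at_top P.
      r + (\<Sum>p\<in>H. (u p - val s p) * \<mu> p) \<in> env_integral X \<SS> \<mu> \<A>"
  proof (rule eventually_finite_subsets_at_top_weakI)
    fix H assume H: "finite H" "H \<subseteq> P"
    have "raw_integral \<A> (r + (\<Sum>p\<in>H. (u p - val s p) * \<mu> p))"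
      by (rule patch[OF s H(1) disj[OF H(2)]]) (use H(2) D(5) P(3) u in auto)
    then show "r + (\<Sum>p\<in>H. (u p - val s p) * \<mu> p) \<in> env_integral X \<SS> \<mu> \<A>"
      unfolding env_integral_eq using closure_subset by blast
  qed
  ultimately have "r + t \<in> env_integral X \<SS> \<mu> \<A>"
    by (intro Lim_in_closed_set[of "env_integral X \<SS> \<mu> \<A>" "\<lambda>H. r + (\<Sum>p\<in>H. (u p - val s p) * \<mu> p)"])
      (auto simp: env_integral_def)
  with 1 show ?thesis by blast
qed

section \<open>Existence and uniqueness of the integral\<close>

text \<open>A point covered by \<open>\<D>\<close> has its value in the fibre of some member of
  \<open>\<D>\<close>. At an uncovered point only 0 is allowed, but the fibre over a set around it
  might not contain 0. Here the step function \<open>s\<close> inside the envelope helps: it is 0 at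
  the point, hence 0 on a small adapted set around it.\<close>

lemma pcov_envelope:
  assumes env: "envelope X \<SS> \<A>" and f: "graph_on X f \<subseteq> \<A>" and P: "spart U P"
  shows "pcov U (\<lambda>x p. f x \<in> const_fibre \<A> p)"
proof -
  obtain s r \<E> where s: "stepr s r \<E>" "graph_on X s \<subseteq> \<A>" using envelope_raw[OF env] .
  obtain \<D> where D: "countable \<D>" "\<D> \<subseteq> \<SS>"
    and A: "\<A> = (\<Union>D\<in>\<D>. const_fibre \<A> D \<times> D) \<union> ({0} \<times> (X - \<Union>\<D>))"
    using env unfolding envelope_def by auto
  note P' = spartD[OF P]
  have UX: "U \<subseteq> X" using P'(1,5) sub_X by blast
  obtain \<Q> where Q: "countable \<Q>" "\<Q> \<subseteq> \<SS>" "\<Union>\<Q> = U"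
     "\<And>x. x\<in>U \<Longrightarrow> \<exists>Q\<in>\<Q>. x \<in> Q \<and> (\<forall>P. P \<subseteq> Q \<longrightarrow> adapted \<E> (insert x P))"
    using pcov_adapted[OF stepr_sets[OF s(1)] P] unfolding pcov_def by metis
  have "\<exists>g. spart (E \<inter> p) g" if "E \<in> \<D>" "p \<in> P" for E p
    using ex_spart_int that D(2) P'(5) by blast
  then obtain g where g: "\<And>E p. E \<in> \<D> \<Longrightarrow> p \<in> P \<Longrightarrow> spart (E \<inter> p) (g E p)" by metis
  note G = spartD[OF g]
  define \<R> where "\<R> = \<Q> \<union> (\<Union>E\<in>\<D>. \<Union>p\<in>P. g E p)"
  have "\<exists>T\<in>\<R>. x \<in> T \<and> (\<forall>p. p \<subseteq> T \<longrightarrow> f x \<in> const_fibre \<A> p)" if x: "x \<in> U" for x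
  proof (cases "x \<in> \<Union>\<D>")
    case True
    have "(f x, x) \<in> \<A>" using f x UX by (auto simp: graph_on_def)
    then have "(f x, x) \<in> (\<Union>D\<in>\<D>. const_fibre \<A> D \<times> D)"
      using True by (subst (asm) A) auto
    then obtain E where E: "E \<in> \<D>" "x \<in> E" "f x \<in> const_fibre \<A> E" by auto
    obtain p where p: "p \<in> P" "x \<in> p" using x P'(1) by auto
    then obtain T where T: "T \<in> g E p" "x \<in> T" using G(1)[OF E(1) p(1)] E(2) by blast
    have "T \<subseteq> E" using G(1)[OF E(1) p(1)] T(1) by blast
    then have "\<forall>p. p \<subseteq> T \<longrightarrow> f x \<in> const_fibre \<A> p" using E(3) mem_const_fibre_mono by blast
    moreover have "T \<in> \<R>" using T(1) E(1) p(1) by (auto simp: \<R>_def)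
    ultimately show ?thesis using T(2) by blast
  next
    case False
    have z: "v = 0" if "(v, x) \<in> \<A>" for v
      using that False by (subst (asm) A) auto
    have fx: "f x = 0" using z f x UX by (auto simp: graph_on_def)
    have sx: "s x = 0" using z s(2) x UX by (auto simp: graph_on_def)
    obtain T where T: "T \<in> \<Q>" "x \<in> T" "\<And>P. P \<subseteq> T \<Longrightarrow> adapted \<E> (insert x P)" using Q(4)[OF x] by metis
    have "f x \<in> const_fibre \<A> p" if p: "p \<subseteq> T" for p
    proof -
      have "(0, y) \<in> \<A>" if y: "y \<in> p" for y
      proof -
        have "s y = 0" using stepr_const[OF s(1) T(3)[OF p], of y x] y sx by simp
        moreover have "y \<in> X" using y p T(1) Q(2) sub_X by blast
        ultimately show ?thesis using s(2) by (force simp: graph_on_def)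
      qed
      then show ?thesis by (simp add: const_fibre_def fx)
    qed
    then show ?thesis using T(1,2) by (auto simp: \<R>_def)
  qed
  moreover have "countable \<R>" using Q(1) D(1) P'(4) G(4) by (auto simp: \<R>_def)
  moreover have "\<R> \<subseteq> \<SS>" using Q(2) G(5) unfolding \<R>_def by blast
  moreover have "\<Union>\<R> = U"
  proof
    show "\<Union>\<R> \<subseteq> U" using Q(3) G(1) P'(1) unfolding \<R>_def by blast
    show "U \<subseteq> \<Union>\<R>" using Q(3) unfolding \<R>_def by blast
  qed
  ultimately show ?thesis unfolding pcov_def by (intro exI[of _ \<R>]) simp
qed

text \<open>One tag serves both envelopes, because both conditions and adaptedness are imposed on
  the same pointwise cover.\<close>

lemma ex_common_value_spart:
  assumes A: "envelope X \<SS> \<A>" "graph_on X f \<subseteq> \<A>" and B: "envelope X \<SS> \<B>" "graph_on X f \<subseteq> \<B>"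
    and E: "finite \<E>" "\<E> \<subseteq> \<SS>" and P: "spart U P"
  obtains Q u where "spart U Q" "\<And>q. q \<in> Q \<Longrightarrow> adapted \<E> q"
    "\<And>q. q \<in> Q \<Longrightarrow> u q \<in> const_fibre \<A> q" "\<And>q. q \<in> Q \<Longrightarrow> u q \<in> const_fibre \<B> q"
proof -
  have "pcov U (\<lambda>x p. adapted \<E> (insert x p) \<and> f x \<in> const_fibre \<A> p \<and> f x \<in> const_fibre \<B> p)"
    by (intro pcov_conj pcov_adapted[OF E P] pcov_envelope[OF A P] pcov_envelope[OF B P])
  from pcov_imp_spart[OF this] obtain Q where Q: "spart U Q"
    "\<And>q. q \<in> Q \<Longrightarrow> \<exists>x\<in>U. adapted \<E> (insert x q) \<and> f x \<in> const_fibre \<A> q \<and> f x \<in> const_fibre \<B> q"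
    by metis
  from Q(2) obtain t where t: "\<And>q. q \<in> Q \<Longrightarrow> adapted \<E> (insert (t q) q)"
    "\<And>q. q \<in> Q \<Longrightarrow> f (t q) \<in> const_fibre \<A> q" "\<And>q. q \<in> Q \<Longrightarrow> f (t q) \<in> const_fibre \<B> q"
    by metis
  show thesis
    by (rule that[of Q "\<lambda>q. f (t q)"]) (use Q(1) t adapted_mono[OF t(1) subset_insertI] in auto)
qed

text \<open>One series over a common partition is a Riemann sum for both envelopes, so its value
  lies in both integrals. Uniqueness and existence of the integral both rest on this.\<close>

lemma env_integrals_meet:
  assumes A: "envelope X \<SS> \<A>" "graph_on X f \<subseteq> \<A>" "osc_le \<A> d"
    and B: "envelope X \<SS> \<B>" "graph_on X f \<subseteq> \<B>" "osc_le \<B> e"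
  shows "\<exists>r. r \<in> env_integral X \<SS> \<mu> \<A> \<and> r \<in> env_integral X \<SS> \<mu> \<B>"
proof -
  obtain s r \<E> where s: "stepr s r \<E>" "graph_on X s \<subseteq> \<A>" using envelope_raw[OF A(1)] .
  obtain t q \<F> where t: "stepr t q \<F>" "graph_on X t \<subseteq> \<B>" using envelope_raw[OF B(1)] .
  have f: "finite (\<E> \<union> \<F>)" "\<E> \<union> \<F> \<subseteq> \<SS>" using stepr_sets[OF s(1)] stepr_sets[OF t(1)] by auto
  obtain P where P: "spart (\<Union>(\<E> \<union> \<F>)) P"
    using spart_of_cover[OF countable_finite[OF f(1)] f(2)] by auto
  obtain Q u where Q: "spart (\<Union>(\<E> \<union> \<F>)) Q" "\<And>q. q \<in> Q \<Longrightarrow> adapted (\<E> \<union> \<F>) q"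
    "\<And>q. q \<in> Q \<Longrightarrow> u q \<in> const_fibre \<A> q" "\<And>q. q \<in> Q \<Longrightarrow> u q \<in> const_fibre \<B> q"
    by (rule ex_common_value_spart[OF A(1,2) B(1,2) f P]) (rule that; assumption)
  have ad: "adapted \<E> q" "adapted \<F> q" if "q \<in> Q" for q using Q(2)[OF that] by (auto simp: adapted_def)
  obtain a where a: "a \<in> env_integral X \<SS> \<mu> \<A>" "((\<lambda>p. u p * \<mu> p) has_sum a) Q"
    using riemann_sum[OF s A(3) Q(1) _ ad(1) Q(3)] by auto
  obtain b where b: "b \<in> env_integral X \<SS> \<mu> \<B>" "((\<lambda>p. u p * \<mu> p) has_sum b) Q"
    using riemann_sum[OF t B(3) Q(1) _ ad(2) Q(4)] by auto
  have "a = b" using has_sum_unique[OF a(2) b(2)] .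
  then show ?thesis using a b by auto
qed

lemma raw_in_env_integral: "raw_integral \<A> r \<Longrightarrow> r \<in> env_integral X \<SS> \<mu> \<A>"
  unfolding env_integral_eq using closure_subset by blast

lemma has_env_integral_osc:
  assumes f: "has_env_integral X \<SS> \<mu> f a" and e: "e > 0"
  obtains \<A> where "envelope X \<SS> \<A>" "graph_on X f \<subseteq> \<A>" "osc_le \<A> e"
    "\<And>r. r \<in> env_integral X \<SS> \<mu> \<A> \<Longrightarrow> \<bar>r - a\<bar> \<le> e"
proof -
  have "0 \<in> interior (ball (0::real) (e / 2))" using e by simp
  then obtain \<A> where A: "envelope X \<SS> \<A>" "graph_on X f \<subseteq> \<A>"
      "env_integral X \<SS> \<mu> \<A> \<subseteq> a +o ball 0 (e / 2)"
    using f unfolding has_env_integral_def by blast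
  have b: "\<bar>r - a\<bar> < e / 2" if "r \<in> env_integral X \<SS> \<mu> \<A>" for r
    using A(3) that by (auto simp: elt_set_plus_def)
  have "osc_le \<A> e" unfolding osc_le_def
  proof (intro allI impI)
    fix r r' assume "raw_integral \<A> r" "raw_integral \<A> r'"
    then show "\<bar>r - r'\<bar> \<le> e" using b[OF raw_in_env_integral, of r] b[OF raw_in_env_integral, of r'] by linarith
  qed
  moreover have "\<bar>r - a\<bar> \<le> e" if "r \<in> env_integral X \<SS> \<mu> \<A>" for r using b[OF that] e by linarith
  ultimately show thesis using A(1,2) that by blast
qed

text \<open>Locates the integral from the oscillation alone: any value is within \<open>d\<close> of
  a point shared with an envelope whose values are arbitrarily close to \<open>a\<close>.\<close>

lemma has_env_integral_near:
  assumes f: "has_env_integral X \<SS> \<mu> f a"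
    and A: "envelope X \<SS> \<A>" "graph_on X f \<subseteq> \<A>" "osc_le \<A> d"
    and r: "r \<in> env_integral X \<SS> \<mu> \<A>"
  shows "\<bar>r - a\<bar> \<le> d"
proof (rule field_le_epsilon)
  fix e :: real assume e: "e > 0"
  obtain \<B> where B: "envelope X \<SS> \<B>" "graph_on X f \<subseteq> \<B>" "osc_le \<B> e"
    "\<And>r. r \<in> env_integral X \<SS> \<mu> \<B> \<Longrightarrow> \<bar>r - a\<bar> \<le> e" using has_env_integral_osc[OF f e] by blast
  obtain t where t: "t \<in> env_integral X \<SS> \<mu> \<A>" "t \<in> env_integral X \<SS> \<mu> \<B>"
    using env_integrals_meet[OF A B(1-3)] by auto
  show "\<bar>r - a\<bar> \<le> d + e"
    using osc_le_closure[OF A(3) r t(1)] B(4)[OF t(2)] by linarith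
qed

lemma has_env_integral_unique:
  assumes a: "has_env_integral X \<SS> \<mu> f a" and b: "has_env_integral X \<SS> \<mu> f b"
  shows "a = b"
proof -
  have "\<bar>a - b\<bar> \<le> 0"
  proof (rule field_le_epsilon)
    fix e :: real assume e: "e > 0"
    have e2: "e / 2 > 0" using e by simp
    obtain \<B> where B: "envelope X \<SS> \<B>" "graph_on X f \<subseteq> \<B>" "osc_le \<B> (e / 2)"
      "\<And>r. r \<in> env_integral X \<SS> \<mu> \<B> \<Longrightarrow> \<bar>r - a\<bar> \<le> e / 2" using has_env_integral_osc[OF a e2] by blast
    \<comment> \<open>Letting the envelope meet itself just provides an element of its
      integral.\<close>
    obtain t where t: "t \<in> env_integral X \<SS> \<mu> \<B>"
      using env_integrals_meet[OF B(1-3) B(1-3)] by auto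
    show "\<bar>a - b\<bar> \<le> 0 + e"
      using B(4)[OF t] has_env_integral_near[OF b B(1-3) t] by linarith
  qed
  then show ?thesis by simp
qed

lemma the_env_integral_eq: "has_env_integral X \<SS> \<mu> f a \<Longrightarrow> the_env_integral X \<SS> \<mu> f = a"
  unfolding the_env_integral_def using has_env_integral_unique by blast

text \<open>A Cauchy criterion: integrals of any two of the envelopes meet, so arbitrarily chosen
  elements form a Cauchy sequence, whose limit is the integral.\<close>

lemma env_integrable_if_small_osc:
  assumes "\<And>e. e > 0 \<Longrightarrow> \<exists>\<A>. envelope X \<SS> \<A> \<and> graph_on X f \<subseteq> \<A> \<and> osc_le \<A> e"
  shows "env_integrable X \<SS> \<mu> f"
proof -
  have pos: "inverse (real (Suc n)) > 0" for n by simp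
  obtain \<A> where A: "\<And>n. envelope X \<SS> (\<A> n)" "\<And>n. graph_on X f \<subseteq> \<A> n"
      "\<And>n. osc_le (\<A> n) (inverse (real (Suc n)))"
    using assms[OF pos] by metis
  have "\<exists>r. r \<in> env_integral X \<SS> \<mu> (\<A> n)" for n
    using env_integrals_meet[OF A(1-3) A(1-3)] by blast
  then obtain r where r: "\<And>n. r n \<in> env_integral X \<SS> \<mu> (\<A> n)" by metis
  have rr: "\<bar>r m - r n\<bar> \<le> inverse (real (Suc m)) + inverse (real (Suc n))" for m n
  proof -
    obtain t where t: "t \<in> env_integral X \<SS> \<mu> (\<A> m)" "t \<in> env_integral X \<SS> \<mu> (\<A> n)"
      using env_integrals_meet[OF A(1-3) A(1-3)] by blast
    show ?thesis using osc_le_closure[OF A(3) r t(1)] osc_le_closure[OF A(3) r t(2)] by linarith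
  qed
  have "Cauchy r"
  proof (rule metric_CauchyI)
    fix e :: real assume "e > 0"
    then obtain N where N: "inverse (real (Suc N)) < e / 2" using reals_Archimedean[of "e / 2"] by auto
    have "dist (r m) (r n) < e" if "m \<ge> N" "n \<ge> N" for m n
    proof -
      have "inverse (real (Suc m)) \<le> inverse (real (Suc N))" "inverse (real (Suc n)) \<le> inverse (real (Suc N))"
        using that by (simp_all add: field_simps)
      then show ?thesis using rr[of m n] N unfolding dist_real_def by linarith
    qed
    then show "\<exists>M. \<forall>m\<ge>M. \<forall>n\<ge>M. dist (r m) (r n) < e" by blast
  qed
  then obtain a where a: "r \<longlonglongrightarrow> a" using real_Cauchy_convergent convergent_def by blast
  have "has_env_integral X \<SS> \<mu> f a" unfolding has_env_integral_def
  proof (intro allI impI)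
    fix T :: "real set" assume "0 \<in> interior T"
    then obtain e where e: "e > 0" "ball 0 e \<subseteq> T" unfolding mem_interior by blast
    obtain N where N: "inverse (real (Suc N)) < e / 2" using reals_Archimedean[of "e / 2"] e(1) by auto
    have "(\<lambda>n. \<bar>r n - a\<bar>) \<longlonglongrightarrow> \<bar>a - a\<bar>" by (intro tendsto_intros a)
    then have "\<forall>\<^sub>F n in sequentially. \<bar>r n - a\<bar> < e / 2"
      by (rule order_tendstoD) (use e in simp)
    then obtain M where M: "\<And>n. n \<ge> M \<Longrightarrow> \<bar>r n - a\<bar> < e / 2" by (auto simp: eventually_sequentially)
    define n where "n = max M N"
    have "inverse (real (Suc n)) \<le> inverse (real (Suc N))" by (simp add: n_def field_simps)
    then have n: "inverse (real (Suc n)) < e / 2" using N by linarith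
    have "env_integral X \<SS> \<mu> (\<A> n) \<subseteq> a +o T"
    proof
      fix t assume t: "t \<in> env_integral X \<SS> \<mu> (\<A> n)"
      have "\<bar>t - r n\<bar> \<le> inverse (real (Suc n))" using osc_le_closure[OF A(3) t r] .
      moreover have "\<bar>r n - a\<bar> < e / 2" by (rule M) (simp add: n_def)
      ultimately have "\<bar>t - a\<bar> < e" using n by linarith
      then have "t - a \<in> T" using e(2) by auto
      then show "t \<in> a +o T" by (auto simp: elt_set_plus_def intro!: bexI[of _ "t - a"])
    qed
    then show "\<exists>\<A>. envelope X \<SS> \<A> \<and> graph_on X f \<subseteq> \<A> \<and> env_integral X \<SS> \<mu> \<A> \<subseteq> a +o T"
      using A(1,2) by blast
  qed
  then show ?thesis unfolding env_integrable_def by blast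
qed

section \<open>Small tails of partitions\<close>

definition finite_packing :: "'a set \<Rightarrow> 'a set set \<Rightarrow> bool" where
  "finite_packing c F \<longleftrightarrow> finite F \<and> F \<subseteq> \<SS> \<and> disjoint F \<and> {} \<notin> F \<and> \<Union>F \<subseteq> c"

text \<open>Truncation at 1 keeps the supremum of the packing sums finite even if the variation on
  \<open>c\<close> is infinite. If the supremum is 0, the empty packing works.\<close>

lemma ex_half_maximal_finite_packing:
  "\<exists>F. finite_packing c F \<and> (\<forall>F'. finite_packing c F' \<longrightarrow> min 1 (\<Sum>p\<in>F'. \<bar>\<mu> p\<bar>) \<le> 2 * (\<Sum>p\<in>F. \<bar>\<mu> p\<bar>))"
proof -
  define T where "T = {min 1 (\<Sum>p\<in>F. \<bar>\<mu> p\<bar>) | F. finite_packing c F}"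
  have e: "finite_packing c {}" by (auto simp: finite_packing_def)
  have zT: "0 \<in> T" unfolding T_def using e by (auto intro!: exI[of _ "{}"])
  have bdd: "bdd_above T" by (rule bdd_aboveI[of _ 1]) (auto simp: T_def)
  have le: "min 1 (\<Sum>p\<in>F. \<bar>\<mu> p\<bar>) \<le> Sup T" if "finite_packing c F" for F
    using that bdd by (intro cSup_upper) (auto simp: T_def)
  show ?thesis
  proof (cases "Sup T \<le> 0")
    case True
    then show ?thesis using le e by (intro exI[of _ "{}"]) force
  next
    case False
    then have "Sup T / 2 < Sup T" by simp
    then obtain t where t: "t \<in> T" "Sup T / 2 < t" using less_cSupD[of T "Sup T / 2"] zT by auto
    then obtain F where F: "finite_packing c F" "t = min 1 (\<Sum>p\<in>F. \<bar>\<mu> p\<bar>)" unfolding T_def by blast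
    have "Sup T \<le> 2 * (\<Sum>p\<in>F. \<bar>\<mu> p\<bar>)" using t(2) F(2) by linarith
    then show ?thesis using le F(1) by (intro exI[of _ F]) (auto intro: order_trans)
  qed
qed

text \<open>The variation of \<open>\<mu>\<close> on a member of the partition may be infinite. Almost maximal finite packings,
  completed to one partition of \<open>A\<close>, turn absolute additivity into the bound on the tail.\<close>

lemma ex_small_tail:
  assumes A: "A \<in> \<SS>" and C: "spart A C" and eta: "\<eta> > 0"
  obtains K where "finite K" "K \<subseteq> C"
    "\<And>F. finite F \<Longrightarrow> F \<subseteq> \<SS> \<Longrightarrow> disjoint F \<Longrightarrow> \<Union>F \<subseteq> A - \<Union>K \<Longrightarrow> (\<Sum>p\<in>F. \<bar>\<mu> p\<bar>) \<le> \<eta>"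
proof -
  note C' = spartD[OF C]
  obtain \<F> where F: "\<And>c. finite_packing c (\<F> c)"
      "\<And>c F'. finite_packing c F' \<Longrightarrow> min 1 (\<Sum>p\<in>F'. \<bar>\<mu> p\<bar>) \<le> 2 * (\<Sum>p\<in>\<F> c. \<bar>\<mu> p\<bar>)"
    using ex_half_maximal_finite_packing by metis
  have "\<exists>G. spart (c - \<Union>(\<F> c)) G" if c: "c \<in> C" for c
  proof -
    obtain P where "spart c P" using ex_spart c C'(5) by blast
    from spart_Diff_finite[OF _ _ this, of "\<F> c"] F(1)[of c] show ?thesis by (auto simp: finite_packing_def)
  qed
  then obtain G where G: "\<And>c. c \<in> C \<Longrightarrow> spart (c - \<Union>(\<F> c)) (G c)" by metis
  have cp: "spart c (\<F> c \<union> G c)" if c: "c \<in> C" for c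
  proof (rule spartI)
    note g = spartD[OF G[OF c]] and f = F(1)[of c]
    show "\<Union>(\<F> c \<union> G c) = c" using g(1) f by (auto simp: finite_packing_def)
    show "disjoint (\<F> c \<union> G c)"
      by (rule disjoint_union) (use g(1,2) f in \<open>auto simp: finite_packing_def\<close>)
    show "{} \<notin> \<F> c \<union> G c" "countable (\<F> c \<union> G c)" "\<F> c \<union> G c \<subseteq> \<SS>"
      using g(3-5) f by (auto simp: finite_packing_def countable_finite)
  qed
  define R where "R = (\<Union>c\<in>C. \<F> c \<union> G c)"
  have "spart (\<Union>c\<in>C. c) R" unfolding R_def
    by (rule spart_UN[OF C'(4) spart_disjoint_family[OF C] cp])
  then have R: "spart A R" using C'(1) by simp
  obtain S where S: "((\<lambda>p. \<bar>\<mu> p\<bar>) has_sum S) R"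
    using spart_has_sum(2)[OF A R] by (auto simp: summable_on_def)
  \<comment> \<open>The bound 1/4 makes twice the packing sum less than 1, which removes the
    truncation in \<open>F2\<close>; the other bound gives \<open>2 * \<delta> \<le> \<eta>\<close>
    at the end.\<close>
  define \<delta> where "\<delta> = min \<eta> 1 / 4"
  have \<delta>: "\<delta> > 0" "2 * \<delta> \<le> \<eta>" "\<delta> \<le> 1 / 4" using eta by (auto simp: \<delta>_def)
  obtain R0 where R0: "finite R0" "R0 \<subseteq> R" "dist (\<Sum>p\<in>R0. \<bar>\<mu> p\<bar>) S \<le> \<delta>"
    using has_sum_finite_approximation[OF S \<delta>(1)] by auto
  have small: "(\<Sum>p\<in>H. \<bar>\<mu> p\<bar>) \<le> \<delta>" if H: "finite H" "H \<subseteq> R - R0" for H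
  proof -
    have "(\<Sum>p\<in>R0 \<union> H. \<bar>\<mu> p\<bar>) \<le> S"
      by (rule has_sum_mono2[OF has_sum_finite S]) (use H R0 in auto)
    moreover have "(\<Sum>p\<in>R0 \<union> H. \<bar>\<mu> p\<bar>) = (\<Sum>p\<in>R0. \<bar>\<mu> p\<bar>) + (\<Sum>p\<in>H. \<bar>\<mu> p\<bar>)"
      by (rule sum.union_disjoint) (use H R0 in auto)
    ultimately show ?thesis using R0(3) unfolding dist_real_def by linarith
  qed
  have uniq: "c = c'" if "c \<in> C" "c' \<in> C" "r \<noteq> {}" "r \<subseteq> c" "r \<subseteq> c'" for c c' r
    using disjointD[OF C'(2) that(1,2)] that(3-5) by blast
  have rn: "r \<noteq> {}" if "r \<in> R" for r using spartD(3)[OF R] that by auto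
  have "\<exists>c\<in>C. r \<subseteq> c" if r: "r \<in> R0" for r
  proof -
    obtain c where c: "c \<in> C" "r \<in> \<F> c \<union> G c" using r R0(2) unfolding R_def by blast
    then show ?thesis using spartD(1)[OF cp[OF c(1)]] by blast
  qed
  then obtain par where par: "\<And>r. r \<in> R0 \<Longrightarrow> par r \<in> C" "\<And>r. r \<in> R0 \<Longrightarrow> r \<subseteq> par r" by metis
  \<comment> \<open>\<open>K\<close> consists of the blocks of \<open>C\<close> that contain some
    member of \<open>R0\<close>, so the chosen packings in all other blocks lie in the small tail of
    \<open>R\<close>.\<close>
  define K where "K = par ` R0"
  have FK: "\<F> c \<subseteq> R - R0" if c: "c \<in> C - K" for c
  proof
    fix r assume r: "r \<in> \<F> c"
    have rc: "r \<subseteq> c" using F(1)[of c] r by (auto simp: finite_packing_def)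
    have rR: "r \<in> R" using r c by (auto simp: R_def)
    have "r \<notin> R0"
    proof
      assume r0: "r \<in> R0"
      have "par r = c" using uniq[OF par(1)[OF r0] _ rn[OF rR] par(2)[OF r0] rc] c by auto
      then show False using c r0 by (auto simp: K_def)
    qed
    then show "r \<in> R - R0" using rR by auto
  qed
  have F2: "(\<Sum>p\<in>F'. \<bar>\<mu> p\<bar>) \<le> 2 * (\<Sum>p\<in>\<F> c. \<bar>\<mu> p\<bar>)" if c: "c \<in> C - K" and F': "finite_packing c F'" for c F'
  proof -
    have "(\<Sum>p\<in>\<F> c. \<bar>\<mu> p\<bar>) \<le> \<delta>" by (rule small[OF _ FK[OF c]]) (use F(1)[of c] in \<open>auto simp: finite_packing_def\<close>)
    then show ?thesis using F(2)[OF F'] \<delta>(3) by (simp add: min_def split: if_splits)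
  qed
  \<comment> \<open>First the case of families subordinate to \<open>C\<close>: inside each block,
    the part of \<open>Q\<close> is compared with the chosen packing there.\<close>
  have main: "(\<Sum>p\<in>Q. \<bar>\<mu> p\<bar>) \<le> \<eta>"
    if Q: "finite Q" "Q \<subseteq> \<SS>" "disjoint Q" "{} \<notin> Q" "\<And>q. q \<in> Q \<Longrightarrow> \<exists>c\<in>C - K. q \<subseteq> c" for Q
  proof -
    obtain pa where pa: "\<And>q. q \<in> Q \<Longrightarrow> pa q \<in> C - K" "\<And>q. q \<in> Q \<Longrightarrow> q \<subseteq> pa q" using Q(5) by metis
    have "(\<Sum>p\<in>Q. \<bar>\<mu> p\<bar>) = (\<Sum>c\<in>pa ` Q. \<Sum>p\<in>{p\<in>Q. pa p = c}. \<bar>\<mu> p\<bar>)"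
      by (rule sum.image_gen[OF Q(1)])
    also have "\<dots> \<le> (\<Sum>c\<in>pa ` Q. 2 * (\<Sum>p\<in>\<F> c. \<bar>\<mu> p\<bar>))"
    proof (rule sum_mono)
      fix c assume c: "c \<in> pa ` Q"
      have "finite_packing c {p\<in>Q. pa p = c}" unfolding finite_packing_def
        using Q(1-4) pa(2) by (fastforce simp: disjoint_def)
      then show "(\<Sum>p\<in>{p\<in>Q. pa p = c}. \<bar>\<mu> p\<bar>) \<le> 2 * (\<Sum>p\<in>\<F> c. \<bar>\<mu> p\<bar>)"
        using F2 c pa(1) by blast
    qed
    also have "\<dots> = 2 * (\<Sum>c\<in>pa ` Q. \<Sum>p\<in>\<F> c. \<bar>\<mu> p\<bar>)" by (simp add: sum_distrib_left)
    also have "(\<Sum>c\<in>pa ` Q. \<Sum>p\<in>\<F> c. \<bar>\<mu> p\<bar>) = (\<Sum>p\<in>(\<Union>c\<in>pa ` Q. \<F> c). \<bar>\<mu> p\<bar>)"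
    proof (rule sum.UNION_disjoint[symmetric])
      show "finite (pa ` Q)" using Q(1) by simp
      show "\<forall>c\<in>pa ` Q. finite (\<F> c)" using F(1) by (auto simp: finite_packing_def)
      show "\<forall>c\<in>pa ` Q. \<forall>c'\<in>pa ` Q. c \<noteq> c' \<longrightarrow> \<F> c \<inter> \<F> c' = {}"
      proof (intro ballI impI)
        fix c c' assume c: "c \<in> pa ` Q" "c' \<in> pa ` Q" "c \<noteq> c'"
        have "r \<notin> \<F> c'" if r: "r \<in> \<F> c" for r
        proof
          assume r': "r \<in> \<F> c'"
          have "r \<noteq> {}" "r \<subseteq> c" "r \<subseteq> c'" using F(1)[of c] F(1)[of c'] r r' by (auto simp: finite_packing_def)
          then show False using uniq[of c c' r] c pa(1) by auto
        qed
        then show "\<F> c \<inter> \<F> c' = {}" by auto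
      qed
    qed
    also have "\<dots> \<le> \<delta>"
    proof (rule small)
      show "finite (\<Union>c\<in>pa ` Q. \<F> c)" using Q(1) F(1) by (auto simp: finite_packing_def)
      show "(\<Union>c\<in>pa ` Q. \<F> c) \<subseteq> R - R0" using FK pa(1) by blast
    qed
    finally show ?thesis using \<delta>(2) by linarith
  qed
  show thesis
  proof (rule that[of K])
    show "finite K" "K \<subseteq> C" using R0(1) par(1) by (auto simp: K_def)
    fix F assume Fi: "finite F" "F \<subseteq> \<SS>" "disjoint F" "\<Union>F \<subseteq> A - \<Union>K"
    \<comment> \<open>Members of a general \<open>F\<close> may cross several blocks of
      \<open>C\<close>, so they are first partitioned along \<open>C\<close>.\<close>
    have "\<exists>P. spart p P \<and> (\<forall>q\<in>P. \<exists>c\<in>C. q \<subseteq> c)" if p: "p \<in> F" for p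
    proof -
      obtain P where P: "spart p P" using ex_spart p Fi(2) by blast
      have "p \<inter> A = p" using p Fi(4) by auto
      then show ?thesis using spart_common[OF P C] by metis
    qed
    then obtain P where P: "\<And>p. p \<in> F \<Longrightarrow> spart p (P p)" "\<And>p q. p \<in> F \<Longrightarrow> q \<in> P p \<Longrightarrow> \<exists>c\<in>C. q \<subseteq> c"
      by metis
    have dF: "disjoint_family_on (\<lambda>p. p) F" using Fi(3) by (auto simp: disjoint_def disjoint_family_on_def)
    have PP: "spart (\<Union>p\<in>F. p) (\<Union>p\<in>F. P p)"
      by (rule spart_UN[OF countable_finite[OF Fi(1)] dF P(1)])
    note PP' = spartD[OF PP]
    show "(\<Sum>p\<in>F. \<bar>\<mu> p\<bar>) \<le> \<eta>"
    proof (rule has_sum_sum_le[OF Fi(1)])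
      show "(\<mu> has_sum \<mu> p) (P p)" if "p \<in> F" for p
        using spart_has_sum(1) P(1)[OF that] that Fi(2) by blast
      fix H assume H: "\<And>p. p \<in> F \<Longrightarrow> finite (H p) \<and> H p \<subseteq> P p"
      have "(\<Sum>p\<in>F. \<bar>\<Sum>q\<in>H p. \<mu> q\<bar>) \<le> (\<Sum>p\<in>F. \<Sum>q\<in>H p. \<bar>\<mu> q\<bar>)" by (intro sum_mono sum_abs)
      also have "\<dots> = (\<Sum>q\<in>(\<Union>p\<in>F. H p). \<bar>\<mu> q\<bar>)"
      proof (rule sum.UNION_disjoint[symmetric, OF Fi(1)])
        show "\<forall>p\<in>F. finite (H p)" using H by auto
        show "\<forall>p\<in>F. \<forall>p'\<in>F. p \<noteq> p' \<longrightarrow> H p \<inter> H p' = {}"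
        proof (intro ballI impI)
          fix p p' assume p: "p \<in> F" "p' \<in> F" "p \<noteq> p'"
          have "p \<inter> p' = {}" using disjointD[OF Fi(3) p] .
          moreover have "q \<subseteq> p" "q \<noteq> {}" if "q \<in> H p" for q
            using spartD(1,3)[OF P(1)[OF p(1)]] H[OF p(1)] that by blast+
          moreover have "q \<subseteq> p'" if "q \<in> H p'" for q
            using spartD(1)[OF P(1)[OF p(2)]] H[OF p(2)] that by blast
          ultimately show "H p \<inter> H p' = {}" by blast
        qed
      qed
      also have "\<dots> \<le> \<eta>"
      proof (rule main)
        have sub: "(\<Union>p\<in>F. H p) \<subseteq> (\<Union>p\<in>F. P p)" using H by blast
        show "finite (\<Union>p\<in>F. H p)" using H Fi(1) by auto
        show "(\<Union>p\<in>F. H p) \<subseteq> \<SS>" "{} \<notin> (\<Union>p\<in>F. H p)" using sub PP'(3,5) by blast+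
        show "disjoint (\<Union>p\<in>F. H p)" using sub PP'(2) by (rule pairwise_subset[rotated])
        fix q assume q: "q \<in> (\<Union>p\<in>F. H p)"
        then obtain p where p: "p \<in> F" "q \<in> P p" using sub by blast
        obtain c where c: "c \<in> C" "q \<subseteq> c" using P(2)[OF p] by auto
        have "q \<noteq> {}" "q \<subseteq> p" using spartD(1,3)[OF P(1)[OF p(1)]] p(2) by blast+
        moreover have "p \<inter> \<Union>K = {}" using Fi(4) p(1) by blast
        ultimately have "c \<notin> K" using c(2) by blast
        then show "\<exists>c\<in>C - K. q \<subseteq> c" using c by blast
      qed
      finally show "(\<Sum>p\<in>F. \<bar>\<Sum>q\<in>H p. \<mu> q\<bar>) \<le> \<eta>" .
    qed
  qed
qed

section \<open>Indefinite integrals and a Saks-Henstock estimate\<close>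

text \<open>An envelope of the restriction of \<open>f\<close> to \<open>B\<close>. Allowing the value 0 on all of \<open>B - \<Union>K\<close> is needed
  because it has to contain the graph of a finite step function.\<close>

definition cut_env :: "(real \<times> 'a) set \<Rightarrow> 'a set \<Rightarrow> 'a set set \<Rightarrow> (real \<times> 'a) set" where
  "cut_env \<A> B K = {(v, x). (v, x) \<in> \<A> \<and> x \<in> B} \<union> {0} \<times> (X - \<Union>K)"

lemma mem_cut_env: "(v, x) \<in> cut_env \<A> B K \<longleftrightarrow> (v, x) \<in> \<A> \<and> x \<in> B \<or> v = 0 \<and> x \<in> X \<and> x \<notin> \<Union>K"
  by (auto simp: cut_env_def)

lemma fibre_cut_env: "v \<in> const_fibre \<A> p \<Longrightarrow> p \<subseteq> B \<Longrightarrow> v \<in> const_fibre (cut_env \<A> B K) p"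
  by (auto simp: const_fibre_def mem_cut_env)

text \<open>\<open>s\<close> cut down to \<open>B\<close> need not be a step function, as the sets
  \<open>E j \<inter> B\<close> need not be members. Keeping \<open>s\<close> on the finitely many
  blocks in \<open>K\<close> gives one, and the added zeros allow it to vanish elsewhere.\<close>

lemma step_cut_env:
  assumes s: "stepr s r \<E>" "graph_on X s \<subseteq> \<A>"
    and B: "spart B P" "\<And>p. p \<in> P \<Longrightarrow> adapted \<E> p" and K: "finite K" "K \<subseteq> P"
  obtains s' r' where "stepr s' r' K" "graph_on X s' \<subseteq> cut_env \<A> B K"
proof -
  note D = spartD[OF B(1)]
  let ?s = "\<lambda>x. 0 + (\<Sum>p\<in>K. val s p * indicator p x)"
  have "stepr ?s (0 + (\<Sum>p\<in>K. val s p * \<mu> p)) ((\<lambda>p. p) ` K \<union> {})"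
    by (rule stepr_add[OF K(1) stepr_zero]) (use D(5) K(2) in auto)
  then have "stepr ?s (0 + (\<Sum>p\<in>K. val s p * \<mu> p)) K" by simp
  moreover have "graph_on X ?s \<subseteq> cut_env \<A> B K"
  proof -
    have dK: "disjoint_family_on (\<lambda>p. p) K"
      using spart_disjoint_family[OF B(1)] K(2) by (auto simp: disjoint_family_on_def)
    have "(?s x, x) \<in> cut_env \<A> B K" if x: "x \<in> X" for x
    proof (cases "x \<in> \<Union>K")
      case True
      then obtain p where p: "p \<in> K" "x \<in> p" by auto
      have pP: "p \<in> P" using p(1) K(2) by blast
      have "?s x = val s p" using sum_indicator_disjoint[OF K(1) dK p] by simp
      also have "val s p = s x" by (rule val_eq[OF s(1) B(2)[OF pP] p(2)])
      finally have "?s x = s x" .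
      moreover have "(s x, x) \<in> \<A>" using s(2) x by (auto simp: graph_on_def)
      moreover have "x \<in> B" using pP p(2) D(1) by blast
      ultimately show ?thesis by (simp add: mem_cut_env)
    next
      case False
      then have "?s x = 0" by (auto intro!: sum.neutral simp: indicator_def)
      then show ?thesis using x False by (simp add: mem_cut_env)
    qed
    then show ?thesis by (auto simp: graph_on_def)
  qed
  ultimately show thesis by (rule that)
qed

lemma envelope_cut_env:
  assumes env: "envelope X \<SS> \<A>" and s: "stepr s r \<E>" "graph_on X s \<subseteq> \<A>"
    and B: "B \<in> \<SS>" "spart B P" "\<And>p. p \<in> P \<Longrightarrow> adapted \<E> p" and K: "finite K" "K \<subseteq> P"
  shows "envelope X \<SS> (cut_env \<A> B K)"
proof -
  let ?B = "cut_env \<A> B K"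
  obtain \<D> where D: "countable \<D>" "\<D> \<subseteq> \<SS>"
    and A: "\<A> = (\<Union>D\<in>\<D>. const_fibre \<A> D \<times> D) \<union> ({0} \<times> (X - \<Union>\<D>))"
    using env unfolding envelope_def by auto
  have AX: "\<A> \<subseteq> UNIV \<times> X" using env unfolding envelope_def by auto
  have BX: "B \<subseteq> X" using sub_X B(1) .
  have KB: "\<Union>K \<subseteq> B" using K(2) spartD(1)[OF B(2)] by blast
  have KS: "K \<subseteq> \<SS>" using K(2) spartD(5)[OF B(2)] by blast
  have "\<exists>g. spart (E \<inter> B) g" if "E \<in> \<D>" for E
    using ex_spart_int that D(2) B(1) by blast
  then obtain g where g: "\<And>E. E \<in> \<D> \<Longrightarrow> spart (E \<inter> B) (g E)" by metis
  obtain L where L: "spart (B - \<Union>K) L" using spart_Diff_finite[OF K(1) KS B(2)] by auto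
  note G = spartD[OF g] and L' = spartD[OF L]
  \<comment> \<open>The pieces of \<open>E \<inter> B\<close> carry values of \<open>\<A>\<close>,
    the pieces in \<open>L\<close> carry the added zero.\<close>
  define \<D>' where "\<D>' = (\<Union>E\<in>\<D>. g E) \<union> L"
  have U: "\<Union>\<D>' = (\<Union>\<D> \<inter> B) \<union> (B - \<Union>K)"
  proof -
    have "\<Union>(\<Union>E\<in>\<D>. g E) = (\<Union>E\<in>\<D>. \<Union>(g E))" by auto
    also have "\<dots> = (\<Union>E\<in>\<D>. E \<inter> B)" using G(1) by simp
    finally show ?thesis using L'(1) unfolding \<D>'_def by auto
  qed
  have D'B: "E \<subseteq> B" if "E \<in> \<D>'" for E using U that by blast
  have zero: "v = 0" if "(v, x) \<in> \<A>" "x \<notin> \<Union>\<D>" for v x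
    using that by (subst (asm) A) auto
  have inD: "\<exists>E\<in>\<D>. x \<in> E \<and> v \<in> const_fibre \<A> E" if "(v, x) \<in> \<A>" "x \<in> \<Union>\<D>" for v x
    using that by (subst (asm) A) auto
  have eq: "?B = (\<Union>D\<in>\<D>'. const_fibre ?B D \<times> D) \<union> ({0} \<times> (X - \<Union>\<D>'))" (is "_ = ?R")
  proof (intro equalityI subsetI)
    fix y assume y: "y \<in> ?B"
    obtain v x where vx: "y = (v, x)" by (cases y)
    show "y \<in> ?R"
    proof (cases "x \<in> \<Union>\<D>'")
      case False
      have "v = 0 \<and> x \<in> X"
      proof (cases "(v, x) \<in> \<A> \<and> x \<in> B")
        case True
        then have "x \<notin> \<Union>\<D>" using False U by blast
        then show ?thesis using zero True AX by blast
      next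
        case False
        then show ?thesis using y vx by (auto simp: mem_cut_env)
      qed
      then show ?thesis using False vx by auto
    next
      case True
      have "\<exists>E\<in>\<D>'. x \<in> E \<and> v \<in> const_fibre ?B E"
      proof (cases "(v, x) \<in> \<A> \<and> x \<in> B \<and> x \<in> \<Union>\<D>")
        case True
        then obtain E where E: "E \<in> \<D>" "x \<in> E" "v \<in> const_fibre \<A> E" using inD by blast
        then obtain T where T: "T \<in> g E" "x \<in> T" using G(1)[OF E(1)] True by blast
        have TE: "T \<subseteq> E" "T \<subseteq> B" using G(1)[OF E(1)] T(1) by blast+
        have "v \<in> const_fibre ?B T"
          by (rule fibre_cut_env[OF mem_const_fibre_mono[OF E(3) TE(1)] TE(2)])
        then show ?thesis using T E(1) by (auto simp: \<D>'_def)
      next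
        case F: False
        have v: "v = 0 \<and> x \<in> B - \<Union>K"
        proof (cases "(v, x) \<in> \<A> \<and> x \<in> B")
          case a: True
          then have "x \<notin> \<Union>\<D>" using F by blast
          then show ?thesis using zero a True U by blast
        next
          case False
          then have "v = 0" "x \<notin> \<Union>K" using y vx by (auto simp: mem_cut_env)
          moreover have "x \<in> B" using True U by blast
          ultimately show ?thesis by blast
        qed
        then obtain T where T: "T \<in> L" "x \<in> T" using L'(1) by blast
        have "T \<subseteq> B - \<Union>K" using L'(1) T(1) by blast
        then have "v \<in> const_fibre ?B T" using v BX by (auto simp: const_fibre_def mem_cut_env)
        then show ?thesis using T by (auto simp: \<D>'_def)
      qed
      then show ?thesis using vx by auto
    qed
  next
    fix y assume y: "y \<in> ?R"
    obtain v x where vx: "y = (v, x)" by (cases y)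
    show "y \<in> ?B"
    proof (cases "x \<in> \<Union>\<D>'")
      case True
      then show ?thesis using y vx by (auto simp: const_fibre_def)
    next
      case False
      then have v: "v = 0" "x \<in> X" using y vx by auto
      \<comment> \<open>The added zeros miss \<open>\<Union>K\<close>. A point of
        \<open>\<Union>K\<close> outside the new cover is not covered by \<open>\<D>\<close> either,
        so \<open>\<A>\<close> itself allows 0 there.\<close>
      show ?thesis
      proof (cases "x \<in> \<Union>K")
        case True
        then have "x \<in> B" using KB by blast
        moreover have "x \<notin> \<Union>\<D>" using False U \<open>x \<in> B\<close> by blast
        then have "(0, x) \<in> \<A>" using v(2) by (subst A) auto
        ultimately show ?thesis using v vx by (simp add: mem_cut_env)
      next
        case False
        then show ?thesis using v vx by (simp add: mem_cut_env)
      qed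
    qed
  qed
  obtain s' r' where s': "stepr s' r' K" "graph_on X s' \<subseteq> ?B" using step_cut_env[OF s B(2,3) K] .
  have "step_function \<SS> s'" using s'(1) by (auto simp: stepr_def step_function_def)
  moreover have "?B \<subseteq> UNIV \<times> X" using BX by (auto simp: cut_env_def)
  moreover have "countable \<D>'" using D(1) G(4) L'(4) by (auto simp: \<D>'_def)
  moreover have "\<D>' \<subseteq> \<SS>" using G(5) L'(5) unfolding \<D>'_def by blast
  ultimately show ?thesis unfolding envelope_def using eq s'(2) by (intro conjI exI[of _ s'] exI[of _ \<D>']) simp_all
qed

text \<open>Two step functions in the cut envelope both vanish outside \<open>B\<close>. Inside
  \<open>B\<close>, on blocks adapted to everything in sight, a value foreign to \<open>\<A>\<close>
  is an added zero on a block disjoint from \<open>\<Union>K\<close>. Replacing it by the value of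
  \<open>s\<close> costs at most \<open>M\<close> times the mass of the block. The replaced values
  are controlled by the oscillation of \<open>\<A>\<close>, and two such replacements cost at most
  \<open>2 * M * \<eta>\<close> by the small tail.\<close>

lemma osc_cut_env:
  assumes env: "envelope X \<SS> \<A>" and osc: "osc_le \<A> d" and s: "stepr s r \<E>" "graph_on X s \<subseteq> \<A>"
    and M: "M \<ge> 0" "\<And>x. \<bar>s x\<bar> \<le> M"
    and B: "B \<in> \<SS>" "spart B P" "\<And>p. p \<in> P \<Longrightarrow> adapted \<E> p" and K: "finite K" "K \<subseteq> P"
    and small: "\<And>F. finite F \<Longrightarrow> F \<subseteq> \<SS> \<Longrightarrow> disjoint F \<Longrightarrow> \<Union>F \<subseteq> B - \<Union>K \<Longrightarrow> (\<Sum>p\<in>F. \<bar>\<mu> p\<bar>) \<le> \<eta>"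
  shows "osc_le (cut_env \<A> B K) (d + 2 * M * \<eta>)"
  unfolding osc_le_def
proof (intro allI impI)
  let ?B = "cut_env \<A> B K"
  fix r1 r2 assume "raw_integral ?B r1" "raw_integral ?B r2"
  then obtain t1 \<E>1 t2 \<E>2 where t1: "stepr t1 r1 \<E>1" "graph_on X t1 \<subseteq> ?B"
    and t2: "stepr t2 r2 \<E>2" "graph_on X t2 \<subseteq> ?B" unfolding raw_integral_def by auto
  define \<G> where "\<G> = \<E> \<union> \<E>1 \<union> \<E>2 \<union> K \<union> {B}"
  have KS: "K \<subseteq> \<SS>" using K(2) spartD(5)[OF B(2)] by blast
  have G: "finite \<G>" "\<G> \<subseteq> \<SS>"
    using stepr_sets[OF s(1)] stepr_sets[OF t1(1)] stepr_sets[OF t2(1)] K(1) KS B(1)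
    by (auto simp: \<G>_def)
  obtain P0 where P0: "spart (\<Union>\<G>) P0" using spart_of_cover[OF countable_finite[OF G(1)] G(2)] by auto
  obtain Q where Q: "spart (\<Union>\<G>) Q" "\<And>q. q \<in> Q \<Longrightarrow> adapted \<G> q" using ex_adapted_spart[OF G P0] by auto
  note Q' = spartD[OF Q(1)]
  have ad: "adapted \<E> q" "adapted \<E>1 q" "adapted \<E>2 q" "adapted K q" "adapted {B} q" if "q \<in> Q" for q
    using Q(2)[OF that] by (auto simp: adapted_def \<G>_def)
  have qX: "q \<subseteq> X" if "q \<in> Q" for q using sub_X Q'(5) that by blast
  have "((\<lambda>q. val t1 q * \<mu> q) has_sum r1) Q"
    by (rule stepr_has_sum[OF t1(1) Q(1) _ ad(2)]) (auto simp: \<G>_def)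
  moreover have "((\<lambda>q. val t2 q * \<mu> q) has_sum r2) Q"
    by (rule stepr_has_sum[OF t2(1) Q(1) _ ad(3)]) (auto simp: \<G>_def)
  ultimately have "((\<lambda>q. val t1 q * \<mu> q + (-1) * (val t2 q * \<mu> q)) has_sum r1 + (-1) * r2) Q"
    by (intro has_sum_add has_sum_cmult_right)
  then have hs: "((\<lambda>q. (val t1 q - val t2 q) * \<mu> q) has_sum (r1 - r2)) Q" by (simp add: algebra_simps)
  have sv: "val s q \<in> const_fibre \<A> q" if q: "q \<in> Q" for q
    using val_eq[OF s(1) ad(1)[OF q]] s(2) qX[OF q] by (auto simp: const_fibre_def graph_on_def)
  define w where "w t q = (if val t q \<in> const_fibre \<A> q then val t q else val s q)" for t q
  have w: "w t q \<in> const_fibre \<A> q" if "q \<in> Q" for t q using sv[OF that] by (simp add: w_def)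
  have key: "(q \<inter> B = {} \<longrightarrow> val t q = 0) \<and>
      (q \<subseteq> B \<longrightarrow> \<bar>val t q - w t q\<bar> \<le> (if q \<inter> \<Union>K = {} then M else 0))"
    if q: "q \<in> Q" and t: "stepr t r' \<E>'" "graph_on X t \<subseteq> ?B" and a: "adapted \<E>' q" for q t r' \<E>'
  proof -
    obtain x where x: "x \<in> q" using Q'(3) q by fastforce
    have vq: "(val t q, y) \<in> ?B" if y: "y \<in> q" for y
      using val_eq[OF t(1) a y] t(2) qX[OF q] y by (auto simp: graph_on_def)
    have 1: "val t q = 0" if "q \<inter> B = {}" using vq[OF x] x that by (auto simp: mem_cut_env)
    have 2: "\<bar>val t q - w t q\<bar> \<le> (if q \<inter> \<Union>K = {} then M else 0)" if qB: "q \<subseteq> B"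
    proof (cases "val t q \<in> const_fibre \<A> q")
      case True
      then show ?thesis using M(1) by (simp add: w_def)
    next
      case False
      then obtain y where y: "y \<in> q" "(val t q, y) \<notin> \<A>" by (auto simp: const_fibre_def)
      have z: "val t q = 0" "y \<notin> \<Union>K" using vq[OF y(1)] y(2) by (auto simp: mem_cut_env)
      have "q \<inter> \<Union>K = {}" using ad(4)[OF q] z(2) y(1) unfolding adapted_def by blast
      moreover have "\<bar>val s q\<bar> \<le> M" using M(2) by (simp add: val_def)
      ultimately show ?thesis using False z(1) by (simp add: w_def)
    qed
    show ?thesis using 1 2 by blast
  qed
  note k1 = key[OF _ t1 ad(2)] and k2 = key[OF _ t2 ad(3)]
  show "\<bar>r1 - r2\<bar> \<le> d + 2 * M * \<eta>"
  proof (rule has_sum_abs_le[OF hs])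
    fix H assume H: "finite H" "H \<subseteq> Q"
    define H' where "H' = {q\<in>H. q \<subseteq> B}"
    define H'' where "H'' = {q\<in>H'. q \<inter> \<Union>K = {}}"
    have fin: "finite H'" "finite H''" using H(1) by (auto simp: H'_def H''_def)
    have dj: "disjoint F" if "F \<subseteq> Q" for F using pairwise_subset[OF Q'(2) that] .
    have "(\<Sum>q\<in>H. (val t1 q - val t2 q) * \<mu> q) = (\<Sum>q\<in>H'. (val t1 q - val t2 q) * \<mu> q)"
    proof (rule sum.mono_neutral_right[OF H(1)])
      show "\<forall>q\<in>H - H'. (val t1 q - val t2 q) * \<mu> q = 0"
      proof
        fix q assume q: "q \<in> H - H'"
        then have qQ: "q \<in> Q" using H(2) by blast
        have "q \<inter> B = {}" using ad(5)[OF qQ] q by (auto simp: adapted_def H'_def)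
        then show "(val t1 q - val t2 q) * \<mu> q = 0" using k1[OF qQ qQ] k2[OF qQ qQ] by simp
      qed
    qed (auto simp: H'_def)
    also have "\<bar>\<dots>\<bar> \<le> (\<Sum>q\<in>H'. \<bar>(val t1 q - val t2 q) * \<mu> q\<bar>)" by (rule sum_abs)
    also have "\<dots> \<le> (\<Sum>q\<in>H'. \<bar>(w t1 q - w t2 q) * \<mu> q\<bar> + 2 * M * (if q \<inter> \<Union>K = {} then \<bar>\<mu> q\<bar> else 0))"
    proof (rule sum_mono)
      fix q assume q: "q \<in> H'"
      then have qQ: "q \<in> Q" and qB: "q \<subseteq> B" using H(2) by (auto simp: H'_def)
      let ?m = "if q \<inter> \<Union>K = {} then M else 0"
      have "\<bar>val t1 q - w t1 q\<bar> \<le> ?m" "\<bar>val t2 q - w t2 q\<bar> \<le> ?m"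
        using k1[OF qQ qQ] k2[OF qQ qQ] qB by blast+
      then have "\<bar>val t1 q - val t2 q\<bar> \<le> \<bar>w t1 q - w t2 q\<bar> + 2 * ?m" by linarith
      then have "\<bar>val t1 q - val t2 q\<bar> * \<bar>\<mu> q\<bar> \<le> (\<bar>w t1 q - w t2 q\<bar> + 2 * ?m) * \<bar>\<mu> q\<bar>"
        by (rule mult_right_mono) simp
      then show "\<bar>(val t1 q - val t2 q) * \<mu> q\<bar> \<le> \<bar>(w t1 q - w t2 q) * \<mu> q\<bar> + 2 * M * (if q \<inter> \<Union>K = {} then \<bar>\<mu> q\<bar> else 0)"
        by (cases "q \<inter> \<Union>K = {}") (simp_all only: abs_mult distrib_right if_True if_False, simp_all)
    qed
    also have "\<dots> = (\<Sum>q\<in>H'. \<bar>(w t1 q - w t2 q) * \<mu> q\<bar>) + 2 * M * (\<Sum>q\<in>H''. \<bar>\<mu> q\<bar>)"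
      unfolding H''_def sum.inter_filter[OF fin(1)] sum_distrib_left by (rule sum.distrib)
    also have "(\<Sum>q\<in>H'. \<bar>(w t1 q - w t2 q) * \<mu> q\<bar>) \<le> d"
    proof (rule osc_bound[OF env osc fin(1)])
      show "disjoint_family_on (\<lambda>q. q) H'"
        using spart_disjoint_family[OF Q(1)] H(2) by (auto simp: disjoint_family_on_def H'_def)
    qed (use H(2) Q'(5) w in \<open>auto simp: H'_def\<close>)
    also have "2 * M * (\<Sum>q\<in>H''. \<bar>\<mu> q\<bar>) \<le> 2 * M * \<eta>"
    proof (rule mult_left_mono)
      show "(\<Sum>q\<in>H''. \<bar>\<mu> q\<bar>) \<le> \<eta>"
        by (rule small[OF fin(2) _ dj]) (use H(2) Q'(5) in \<open>auto simp: H'_def H''_def\<close>)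
    qed (use M(1) in simp)
    finally show "\<bar>\<Sum>q\<in>H. (val t1 q - val t2 q) * \<mu> q\<bar> \<le> d + 2 * M * \<eta>" by simp
  qed
qed

text \<open>The last conclusion holds because the sets of the cut step function are blocks of
  \<open>P\<close>. So \<open>P\<close> is adapted to them, and a sum over \<open>P\<close> is a
  Riemann sum for the cut envelope.\<close>

lemma restriction_envelope:
  assumes env: "envelope X \<SS> \<A>" "graph_on X f \<subseteq> \<A>" "osc_le \<A> d"
    and s: "stepr s r \<E>" "graph_on X s \<subseteq> \<A>"
    and B: "B \<in> \<SS>" "spart B P" "\<And>p. p \<in> P \<Longrightarrow> adapted \<E> p" and e: "e > 0"
  obtains \<B> where "envelope X \<SS> \<B>" "graph_on X (restrict_zero f B) \<subseteq> \<B>" "osc_le \<B> (d + e)"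
    "\<And>u t. (\<And>p. p \<in> P \<Longrightarrow> u p \<in> const_fibre \<A> p) \<Longrightarrow> ((\<lambda>p. u p * \<mu> p) has_sum t) P \<Longrightarrow>
        t \<in> env_integral X \<SS> \<mu> \<B>"
proof -
  obtain M where M: "M \<ge> 0" "\<And>x. \<bar>s x\<bar> \<le> M" using stepr_bounded[OF s(1)] by auto
  \<comment> \<open>Chosen for \<open>2 * M * \<eta> \<le> e\<close>; the summand 1 covers the case
    that \<open>M\<close> is 0.\<close>
  define \<eta> where "\<eta> = e / (2 * (M + 1))"
  have eta: "\<eta> > 0" "2 * M * \<eta> \<le> e" using e M(1) by (auto simp: \<eta>_def field_simps)
  obtain K where K: "finite K" "K \<subseteq> P"
    "\<And>F. finite F \<Longrightarrow> F \<subseteq> \<SS> \<Longrightarrow> disjoint F \<Longrightarrow> \<Union>F \<subseteq> B - \<Union>K \<Longrightarrow> (\<Sum>p\<in>F. \<bar>\<mu> p\<bar>) \<le> \<eta>"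
    by (rule ex_small_tail[OF B(1,2) eta(1)]) (rule that; assumption)
  let ?B = "cut_env \<A> B K"
  note D = spartD[OF B(2)]
  have envB: "envelope X \<SS> ?B" by (rule envelope_cut_env[OF env(1) s B K(1,2)])
  have "osc_le ?B (d + 2 * M * \<eta>)" by (rule osc_cut_env[OF env(1,3) s M B K])
  then have osc: "osc_le ?B (d + e)" using eta(2) unfolding osc_le_def by (meson add_left_mono order_trans)
  have KB: "\<Union>K \<subseteq> B" using K(2) D(1) by blast
  have gr: "graph_on X (restrict_zero f B) \<subseteq> ?B"
  proof
    fix y assume "y \<in> graph_on X (restrict_zero f B)"
    then obtain x where x: "x \<in> X" "y = (restrict_zero f B x, x)" by (auto simp: graph_on_def)
    then show "y \<in> ?B" using env(2) KB by (auto simp: graph_on_def restrict_zero_def mem_cut_env)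
  qed
  obtain s' r' where s': "stepr s' r' K" "graph_on X s' \<subseteq> ?B" using step_cut_env[OF s B(2,3) K(1,2)] .
  have aK: "adapted K p" if p: "p \<in> P" for p
    unfolding adapted_def
  proof
    fix k assume "k \<in> K"
    then show "p \<subseteq> k \<or> p \<inter> k = {}" using disjointD[OF D(2) p, of k] K(2) by auto
  qed
  have "t \<in> env_integral X \<SS> \<mu> ?B"
    if u: "\<And>p. p \<in> P \<Longrightarrow> u p \<in> const_fibre \<A> p" and t: "((\<lambda>p. u p * \<mu> p) has_sum t) P" for u t
  proof -
    have "u p \<in> const_fibre ?B p" if "p \<in> P" for p
      by (rule fibre_cut_env[OF u[OF that]]) (use D(1) that in blast)
    from riemann_sum[OF s' osc B(2) KB aK this] t show ?thesis using has_sum_unique by blast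
  qed
  with envB gr osc show thesis by (rule that)
qed

section \<open>Restrictions of an integrable function and their integrals\<close>

lemma env_integrable_restrict:
  assumes f: "env_integrable X \<SS> \<mu> f" and B: "B \<in> \<SS>"
  shows "env_integrable X \<SS> \<mu> (restrict_zero f B)"
proof (rule env_integrable_if_small_osc)
  fix e :: real assume "e > 0"
  then have e2: "e / 2 > 0" by simp
  obtain a where "has_env_integral X \<SS> \<mu> f a" using f by (auto simp: env_integrable_def)
  then obtain \<A> where A: "envelope X \<SS> \<A>" "graph_on X f \<subseteq> \<A>" "osc_le \<A> (e / 2)"
    using has_env_integral_osc[OF _ e2] by metis
  obtain s r \<E> where s: "stepr s r \<E>" "graph_on X s \<subseteq> \<A>" using envelope_raw[OF A(1)] .
  obtain P0 where "spart B P0" using ex_spart[OF B] by auto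
  then obtain P where P: "spart B P" "\<And>p. p \<in> P \<Longrightarrow> adapted \<E> p"
    using ex_adapted_spart[OF stepr_sets[OF s(1)]] by metis
  obtain \<B> where "envelope X \<SS> \<B>" "graph_on X (restrict_zero f B) \<subseteq> \<B>" "osc_le \<B> (e / 2 + e / 2)"
    using restriction_envelope[OF A s B P e2] by metis
  then show "\<exists>\<A>. envelope X \<SS> \<A> \<and> graph_on X (restrict_zero f B) \<subseteq> \<A> \<and> osc_le \<A> e" by auto
qed

definition indef :: "('a \<Rightarrow> real) \<Rightarrow> 'a set \<Rightarrow> real" where
  "indef f B = the_env_integral X \<SS> \<mu> (restrict_zero f B)"

lemma has_env_integral_indef:
  assumes "env_integrable X \<SS> \<mu> f" "B \<in> \<SS>"
  shows "has_env_integral X \<SS> \<mu> (restrict_zero f B) (indef f B)"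
  using env_integrable_restrict[OF assms] the_env_integral_eq
  unfolding env_integrable_def indef_def by metis

lemma riemann_sum_indef:
  assumes f: "env_integrable X \<SS> \<mu> f"
    and env: "envelope X \<SS> \<A>" "graph_on X f \<subseteq> \<A>" "osc_le \<A> d"
    and s: "stepr s r \<E>" "graph_on X s \<subseteq> \<A>"
    and B: "B \<in> \<SS>" "spart B P" "\<And>p. p \<in> P \<Longrightarrow> adapted \<E> p"
    and u: "\<And>p. p \<in> P \<Longrightarrow> u p \<in> const_fibre \<A> p" "((\<lambda>p. u p * \<mu> p) has_sum t) P"
  shows "\<bar>t - indef f B\<bar> \<le> d"
proof (rule field_le_epsilon)
  fix e :: real assume e: "e > 0"
  obtain \<B> where \<B>: "envelope X \<SS> \<B>" "graph_on X (restrict_zero f B) \<subseteq> \<B>" "osc_le \<B> (d + e)"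
    "t \<in> env_integral X \<SS> \<mu> \<B>"
    using restriction_envelope[OF env s B e] u by metis
  show "\<bar>t - indef f B\<bar> \<le> d + e"
    by (rule has_env_integral_near[OF has_env_integral_indef[OF f B(1)] \<B>])
qed

text \<open>Compare \<open>w i\<close> with tags \<open>u i q\<close> on a partition of
  \<open>A i\<close> that are compatible both with \<open>\<A>\<close> and with an envelope
  \<open>\<B>\<close> of tiny oscillation. Through \<open>\<B>\<close>, the sums of the tags
  approximate the integrals over the \<open>A i\<close>; through \<open>\<A>\<close>, exchanging
  \<open>w i\<close> for the tags costs at most \<open>d\<close> in total, simultaneously for all
  \<open>i\<close>.\<close>

lemma henstock:
  assumes f: "env_integrable X \<SS> \<mu> f"
    and env: "envelope X \<SS> \<A>" "graph_on X f \<subseteq> \<A>" "osc_le \<A> d"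
    and I: "finite I" "disjoint_family_on A I" and A: "\<And>i. i \<in> I \<Longrightarrow> A i \<in> \<SS>"
    and w: "\<And>i. i \<in> I \<Longrightarrow> w i \<in> const_fibre \<A> (A i)"
  shows "(\<Sum>i\<in>I. \<bar>w i * \<mu> (A i) - indef f (A i)\<bar>) \<le> d"
proof (rule field_le_epsilon)
  fix e :: real assume e: "e > 0"
  define e' where "e' = e / (card I + 1)"
  have e': "e' > 0" using e by (simp add: e'_def)
  have ce: "card I * e' \<le> e" using e by (simp add: e'_def field_simps)
  obtain a where "has_env_integral X \<SS> \<mu> f a" using f by (auto simp: env_integrable_def)
  then obtain \<B> where B: "envelope X \<SS> \<B>" "graph_on X f \<subseteq> \<B>" "osc_le \<B> e'"
    using has_env_integral_osc[OF _ e'] by metis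
  obtain s r \<E> where s: "stepr s r \<E>" "graph_on X s \<subseteq> \<B>" using envelope_raw[OF B(1)] .
  have "\<exists>Q u. spart (A i) Q \<and> (\<forall>q\<in>Q. adapted \<E> q \<and> u q \<in> const_fibre \<A> q \<and> u q \<in> const_fibre \<B> q)"
    if i: "i \<in> I" for i
  proof -
    obtain P where P: "spart (A i) P" using ex_spart[OF A[OF i]] by auto
    obtain Q u where "spart (A i) Q" "\<And>q. q \<in> Q \<Longrightarrow> adapted \<E> q"
      "\<And>q. q \<in> Q \<Longrightarrow> u q \<in> const_fibre \<A> q" "\<And>q. q \<in> Q \<Longrightarrow> u q \<in> const_fibre \<B> q"
      by (rule ex_common_value_spart[OF env(1,2) B(1,2) stepr_sets[OF s(1)] P]) (rule that; assumption)
    then show ?thesis by blast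
  qed
  then obtain Q u where Q: "\<And>i. i \<in> I \<Longrightarrow> spart (A i) (Q i)"
    "\<And>i q. i \<in> I \<Longrightarrow> q \<in> Q i \<Longrightarrow> adapted \<E> q" and u: "\<And>i q. i \<in> I \<Longrightarrow> q \<in> Q i \<Longrightarrow> u i q \<in> const_fibre \<A> q"
    "\<And>i q. i \<in> I \<Longrightarrow> q \<in> Q i \<Longrightarrow> u i q \<in> const_fibre \<B> q" by metis
  have bound: "(\<Sum>i\<in>J. \<Sum>q\<in>H i. \<bar>(w i - u i q) * \<mu> q\<bar>) \<le> d"
    if J: "J \<subseteq> I" and H: "\<And>i. i \<in> J \<Longrightarrow> finite (H i) \<and> H i \<subseteq> Q i" for J H
  proof -
    have fJ: "finite J" using J I(1) finite_subset by blast
    have "(\<Sum>i\<in>J. \<Sum>q\<in>H i. \<bar>(w i - u i q) * \<mu> q\<bar>) = (\<Sum>k\<in>Sigma J H. \<bar>(w (fst k) - u (fst k) (snd k)) * \<mu> (snd k)\<bar>)"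
      by (rule sum_fst_Sigma[OF fJ]) (use H in blast)
    also have "\<dots> \<le> d"
    proof (rule osc_bound[OF env(1,3)])
      have dJ: "disjoint_family_on A J" using I(2) J by (auto simp: disjoint_family_on_def)
      show "disjoint_family_on snd (Sigma J H)"
        by (rule disjoint_family_Sigma[OF dJ, of Q]) (use H J Q(1) in blast)+
      show "finite (Sigma J H)" using fJ H by auto
      fix k assume k: "k \<in> Sigma J H"
      then have k': "fst k \<in> I" "snd k \<in> Q (fst k)" using H J by (auto simp: subset_iff)
      have sub: "snd k \<subseteq> A (fst k)" using spartD(1)[OF Q(1)[OF k'(1)]] k'(2) by blast
      show "snd k \<in> \<SS>" using spartD(5)[OF Q(1)[OF k'(1)]] k'(2) by blast
      show "w (fst k) \<in> const_fibre \<A> (snd k)" using mem_const_fibre_mono[OF w sub] k' by auto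
      show "u (fst k) (snd k) \<in> const_fibre \<A> (snd k)" using u(1) k' by auto
    qed
    finally show ?thesis .
  qed
  have "\<exists>c. ((\<lambda>q. (w i - u i q) * \<mu> q) has_sum c) (Q i)" if i: "i \<in> I" for i
  proof -
    have "(\<lambda>q. (w i - u i q) * \<mu> q) summable_on Q i"
      by (rule bounded_abs_sums_summable[where d = d]) (use bound[of "{i}" "\<lambda>_. H" for H] i in auto)
    then show ?thesis by (simp add: summable_on_def)
  qed
  then obtain c where c: "\<And>i. i \<in> I \<Longrightarrow> ((\<lambda>q. (w i - u i q) * \<mu> q) has_sum c i) (Q i)" by metis
  have near: "\<bar>(w i * \<mu> (A i) - c i) - indef f (A i)\<bar> \<le> e'" if i: "i \<in> I" for i
  proof -
    have "((\<lambda>q. w i * \<mu> q + (-1) * ((w i - u i q) * \<mu> q)) has_sum (w i * \<mu> (A i) + (-1) * c i)) (Q i)"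
      by (intro has_sum_add has_sum_cmult_right c[OF i] spart_has_sum(1)[OF A[OF i] Q(1)[OF i]])
    then have "((\<lambda>q. u i q * \<mu> q) has_sum (w i * \<mu> (A i) - c i)) (Q i)" by (simp add: algebra_simps)
    then show ?thesis
      using riemann_sum_indef[OF f B s A[OF i] Q(1)[OF i] Q(2)[OF i], of "u i"] u(2)[OF i] by simp
  qed
  have "(\<Sum>i\<in>I. \<bar>c i\<bar>) \<le> d"
  proof (rule has_sum_sum_le[OF I(1) c])
    fix H assume H: "\<And>i. i \<in> I \<Longrightarrow> finite (H i) \<and> H i \<subseteq> Q i"
    have "(\<Sum>i\<in>I. \<bar>\<Sum>q\<in>H i. (w i - u i q) * \<mu> q\<bar>) \<le> (\<Sum>i\<in>I. \<Sum>q\<in>H i. \<bar>(w i - u i q) * \<mu> q\<bar>)"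
      by (intro sum_mono sum_abs)
    also have "\<dots> \<le> d" by (rule bound[OF order_refl H])
    finally show "(\<Sum>i\<in>I. \<bar>\<Sum>q\<in>H i. (w i - u i q) * \<mu> q\<bar>) \<le> d" .
  qed
  moreover have "(\<Sum>i\<in>I. \<bar>w i * \<mu> (A i) - indef f (A i)\<bar>) \<le> (\<Sum>i\<in>I. \<bar>c i\<bar> + e')"
  proof (rule sum_mono)
    fix i assume i: "i \<in> I"
    show "\<bar>w i * \<mu> (A i) - indef f (A i)\<bar> \<le> \<bar>c i\<bar> + e'" using near[OF i] by linarith
  qed
  moreover have "(\<Sum>i\<in>I. \<bar>c i\<bar> + e') = (\<Sum>i\<in>I. \<bar>c i\<bar>) + card I * e'" by (simp add: sum.distrib)
  ultimately show "(\<Sum>i\<in>I. \<bar>w i * \<mu> (A i) - indef f (A i)\<bar>) \<le> d + e" using ce by linarith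
qed

end

section \<open>The series of step functions\<close>

lemma has_abs_sumI: "(g has_sum a) I \<Longrightarrow> has_abs_sum g I a"
  unfolding has_abs_sum_def using summable_on_iff_abs_summable_on_real[of g I]
  by (auto simp: summable_on_def)

text \<open>Transport along an injection into the naturals, so that the series can be built with
  triples as indices.\<close>

lemma nat_indexed_families:
  fixes c :: "'i \<Rightarrow> real" and E :: "'i \<Rightarrow> 'a set" and V :: "real \<Rightarrow> 'a set \<Rightarrow> real set"
  assumes I: "countable I" and E: "\<And>i. i \<in> I \<Longrightarrow> E i \<in> \<SS>"
    and pw: "\<And>x. x \<in> X \<Longrightarrow> has_abs_sum (\<lambda>i. c i * indicator (E i) x) I (f x) \<or>
                  completely_divergent (\<lambda>i. c i * indicator (E i) x) I"
    and sub: "set_family_sum I (\<lambda>i. V (c i) (E i)) \<subseteq> Z"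
  shows "\<exists>(\<Lambda> :: nat set) (c :: nat \<Rightarrow> real) (E :: nat \<Rightarrow> 'a set).
           (\<forall>l\<in>\<Lambda>. E l \<in> \<SS>) \<and>
           (\<forall>x\<in>X. has_abs_sum (\<lambda>l. c l * indicator (E l) x) \<Lambda> (f x) \<or>
                  completely_divergent (\<lambda>l. c l * indicator (E l) x) \<Lambda>) \<and>
           set_family_sum \<Lambda> (\<lambda>l. V (c l) (E l)) \<subseteq> Z"
proof -
  define h where "h = to_nat_on I"
  have inj: "inj_on h I" unfolding h_def using I by (rule inj_on_to_nat_on)
  define k where "k = the_inv_into I h"
  have kh: "k (h i) = i" if "i \<in> I" for i
    unfolding k_def by (rule the_inv_into_f_f[OF inj that])
  have abs: "has_abs_sum g (h ` I) a" if "has_abs_sum (\<lambda>i. g (h i)) I a" for g a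
    using that unfolding has_abs_sum_def has_sum_reindex[OF inj] summable_on_reindex[OF inj] o_def .
  have infs: "infsum g (h ` J) = (\<Sum>\<^sub>\<infinity>i\<in>J. g (h i))" if "J \<subseteq> I" for J and g :: "nat \<Rightarrow> ennreal"
    using infsum_reindex[OF inj_on_subset[OF inj that], of g] by (simp add: o_def)
  have div: "completely_divergent g (h ` I)" if "completely_divergent (\<lambda>i. g (h i)) I" for g
  proof -
    have "{l \<in> h ` I. (0::real) < g l} = h ` {i\<in>I. g (h i) > 0}" "{l \<in> h ` I. g l < 0} = h ` {i\<in>I. g (h i) < 0}" by auto
    then show ?thesis
      using that unfolding completely_divergent_def
      by (simp add: infs)
  qed
  show ?thesis
  proof (intro exI[of _ "h ` I"] exI[of _ "\<lambda>l. c (k l)"] exI[of _ "\<lambda>l. E (k l)"] conjI ballI)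
    fix l assume "l \<in> h ` I"
    then show "E (k l) \<in> \<SS>" using E kh by auto
  next
    fix x assume x: "x \<in> X"
    let ?g = "\<lambda>l. c (k l) * indicator (E (k l)) x"
    have eq: "?g (h i) = c i * indicator (E i) x" if "i \<in> I" for i using kh[OF that] by simp
    from pw[OF x] show "has_abs_sum ?g (h ` I) (f x) \<or> completely_divergent ?g (h ` I)"
    proof
      assume a: "has_abs_sum (\<lambda>i. c i * indicator (E i) x) I (f x)"
      have "has_abs_sum (\<lambda>i. ?g (h i)) I (f x)"
        by (rule has_abs_sumI) (use a eq in \<open>simp add: has_abs_sum_def cong: has_sum_cong\<close>)
      from abs[of ?g, OF this] show ?thesis ..
    next
      assume a: "completely_divergent (\<lambda>i. c i * indicator (E i) x) I"
      have s: "{i\<in>I. ?g (h i) > 0} = {i\<in>I. c i * indicator (E i) x > 0}"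
        "{i\<in>I. ?g (h i) < 0} = {i\<in>I. c i * indicator (E i) x < 0}" using eq by auto
      have e: "(\<Sum>\<^sub>\<infinity>i\<in>J. ennreal (?g (h i))) = (\<Sum>\<^sub>\<infinity>i\<in>J. ennreal (c i * indicator (E i) x))"
        "(\<Sum>\<^sub>\<infinity>i\<in>J. ennreal (- ?g (h i))) = (\<Sum>\<^sub>\<infinity>i\<in>J. ennreal (- (c i * indicator (E i) x)))"
        if "J \<subseteq> I" for J
        by (intro infsum_cong; use eq that in auto)+
      have "completely_divergent (\<lambda>i. ?g (h i)) I"
        using a unfolding completely_divergent_def s e(1)[OF Collect_restrict] e(2)[OF Collect_restrict] .
      from div[of ?g, OF this] show ?thesis ..
    qed
  next
    show "set_family_sum (h ` I) (\<lambda>l. V (c (k l)) (E (k l))) \<subseteq> Z"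
    proof
      fix z assume "z \<in> set_family_sum (h ` I) (\<lambda>l. V (c (k l)) (E (k l)))"
      then obtain a where a: "z = (\<Sum>l\<in>{l. l \<in> h ` I \<and> a l \<noteq> 0}. a l)"
        "\<forall>l\<in>h ` I. a l \<in> V (c (k l)) (E (k l))" "finite {l. l \<in> h ` I \<and> a l \<noteq> 0}"
        unfolding set_family_sum_def by blast
      let ?T = "{i. i \<in> I \<and> a (h i) \<noteq> 0}"
      have im: "{l. l \<in> h ` I \<and> a l \<noteq> 0} = h ` ?T" by auto
      have injT: "inj_on h ?T" by (rule inj_on_subset[OF inj]) auto
      have "finite ?T" using a(3) unfolding im using injT by (rule finite_imageD)
      moreover have "z = (\<Sum>i\<in>?T. a (h i))" unfolding a(1) im by (simp add: sum.reindex[OF injT])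
      moreover have "\<forall>i\<in>I. a (h i) \<in> V (c i) (E i)" using a(2) kh by auto
      ultimately have "z \<in> set_family_sum I (\<lambda>i. V (c i) (E i))"
        unfolding set_family_sum_def by (intro CollectI exI[of _ "\<lambda>i. a (h i)"]) simp
      then show "z \<in> Z" using sub by blast
    qed
  qed
qed

text \<open>At a fixed point, disjointness leaves at most one contributing set per level, so the sum
  over pairs of level and set is a sum over the levels that cover the point.\<close>

lemma has_sum_levels:
  fixes Q :: "nat \<Rightarrow> 'a set set" and D :: "nat \<Rightarrow> 'a set \<Rightarrow> real"
  assumes dis: "\<And>n. disjoint (Q n)" and D: "\<And>n q. q \<in> Q n \<Longrightarrow> x \<in> q \<Longrightarrow> D n q = \<delta> n"
    and s: "(\<delta> has_sum s) {n. x \<in> \<Union>(Q n)}"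
  shows "((\<lambda>i. D (fst (snd i)) (snd (snd i)) * indicator (snd (snd i)) x) has_sum s) ({k} \<times> Sigma UNIV Q)"
proof -
  let ?N = "{n. x \<in> \<Union>(Q n)}"
  have "\<forall>n\<in>?N. \<exists>q\<in>Q n. x \<in> q" by auto
  then obtain q where q: "\<And>n. n \<in> ?N \<Longrightarrow> q n \<in> Q n" "\<And>n. n \<in> ?N \<Longrightarrow> x \<in> q n" by metis
  have uniq: "p = q n" if "p \<in> Q n" "x \<in> p" for p n
  proof -
    have "n \<in> ?N" using that by auto
    then show ?thesis using disjointD[OF dis that(1) q(1)] q(2) that(2) by blast
  qed
  let ?h = "\<lambda>n. (k, n, q n)"
  let ?g = "\<lambda>i. D (fst (snd i)) (snd (snd i)) * indicator (snd (snd i)) x"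
  have inj: "inj_on ?h ?N" by (auto simp: inj_on_def)
  have "(?g \<circ> ?h) n = \<delta> n" if "n \<in> ?N" for n using D[OF q(1,2)[OF that]] q(2)[OF that] by simp
  then have "((?g \<circ> ?h) has_sum s) ?N" using s by (simp only: cong: has_sum_cong)
  then have "(?g has_sum s) (?h ` ?N)" using has_sum_reindex[OF inj] by blast
  moreover have "(?g has_sum s) ({k} \<times> Sigma UNIV Q) \<longleftrightarrow> (?g has_sum s) (?h ` ?N)"
  proof (rule has_sum_cong_neutral)
    fix i assume i: "i \<in> ?h ` ?N - {k} \<times> Sigma UNIV Q"
    then show "?g i = 0" using q(1) by auto
  next
    fix i assume i: "i \<in> {k} \<times> Sigma UNIV Q - ?h ` ?N"
    obtain n p where np: "i = (k, n, p)" "p \<in> Q n" using i by auto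
    have "x \<notin> p"
    proof
      assume x: "x \<in> p"
      have "n \<in> ?N" using x np(2) by auto
      then show False using uniq[OF np(2) x] i np(1) by auto
    qed
    then show "?g i = 0" by (simp add: np(1))
  qed simp
  ultimately show ?thesis by blast
qed

text \<open>Terms are triples (kind, level, set): kind 1 for the differences \<open>F\<^sub>n - F\<^sub>n\<^sub>-\<^sub>1\<close>, kinds 2 and 3 for
  the terms \<open>+1\<close> and \<open>-1\<close> on the bad sets.\<close>

definition term_index :: "(nat \<Rightarrow> 'a set set) \<Rightarrow> (nat \<Rightarrow> 'a set set) \<Rightarrow> (nat \<times> nat \<times> 'a set) set" where
  "term_index Q G = {1} \<times> Sigma UNIV Q \<union> ({2} \<times> Sigma UNIV G \<union> {3} \<times> Sigma UNIV G)"

definition term_coeff :: "(nat \<Rightarrow> 'a set \<Rightarrow> real) \<Rightarrow> nat \<times> nat \<times> 'a set \<Rightarrow> real" where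
  "term_coeff D i = (if fst i = 1 then D (fst (snd i)) (snd (snd i)) else if fst i = 2 then 1 else - 1)"

lemma telescoping_has_sum:
  fixes F :: "nat \<Rightarrow> real"
  assumes "finite N" "\<And>n. n \<notin> N \<Longrightarrow> \<bar>F n - y\<bar> \<le> (1/2) ^ n"
  shows "((\<lambda>n. F n - (if n = 0 then 0 else F (n - 1))) has_sum y) UNIV"
proof -
  let ?d = "\<lambda>n. F n - (if n = 0 then 0 else F (n - 1))"
  obtain M where M: "\<And>n. n \<in> N \<Longrightarrow> n < M" using assms(1) unfolding finite_nat_set_iff_bounded by auto
  have near: "\<bar>F n - y\<bar> \<le> (1/2) ^ n" if "n \<ge> M" for n using assms(2)[of n] M[of n] that by force
  \<comment> \<open>The factor is 1 + 2: the deviation at level n is at most 2^(-n), that at level n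
    - 1 at most twice as much.\<close>
  have dn: "\<bar>?d n\<bar> \<le> 3 * (1/2) ^ n" if n: "n \<ge> Suc M" for n
  proof -
    obtain m where m: "n = Suc m" "m \<ge> M" using n by (cases n) auto
    have "\<bar>F (Suc m) - y\<bar> \<le> 1/2 * (1/2) ^ m" "\<bar>F m - y\<bar> \<le> (1/2) ^ m"
      using near[of "Suc m"] near[of m] m by simp_all
    then have "\<bar>F (Suc m) - F m\<bar> \<le> 3 * (1/2 * (1/2) ^ m)" by linarith
    then show ?thesis unfolding m(1) by simp
  qed
  have "summable (\<lambda>n. norm (?d n))"
  proof (rule summable_comparison_test_ev)
    show "\<forall>\<^sub>F n in sequentially. norm (norm (?d n)) \<le> 3 * (1/2) ^ n"
      using dn unfolding eventually_sequentially real_norm_def abs_abs by blast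
    show "summable (\<lambda>n. 3 * (1/2::real) ^ n)" by (intro summable_mult summable_geometric) simp
  qed
  moreover have "?d sums y"
  proof -
    have ps: "(\<Sum>n<Suc m. ?d n) = F m" for m by (induction m) auto
    have "(\<lambda>m. F m - y) \<longlonglongrightarrow> 0"
    proof (rule Lim_null_comparison)
      show "\<forall>\<^sub>F n in sequentially. norm (F n - y) \<le> (1/2) ^ n"
        using near unfolding eventually_sequentially real_norm_def by blast
      show "(\<lambda>n. (1/2::real) ^ n) \<longlonglongrightarrow> 0" by (rule LIMSEQ_realpow_zero) auto
    qed
    then have "F \<longlonglongrightarrow> y" by (simp add: LIM_zero_iff)
    then have "(\<lambda>m. \<Sum>n<Suc m. ?d n) \<longlonglongrightarrow> y" unfolding ps .
    then show ?thesis unfolding sums_def by (rule LIMSEQ_imp_Suc)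
  qed
  ultimately show ?thesis by (rule norm_summable_imp_has_sum)
qed

text \<open>Each of the infinitely many levels covering \<open>x\<close> contributes a term equal to
  1.\<close>

lemma infinite_levels_diverge:
  fixes g :: "nat \<times> nat \<times> 'a set \<Rightarrow> real"
  assumes inf: "infinite {n. x \<in> \<Union>(G n)}"
    and sub: "{k} \<times> Sigma UNIV G \<subseteq> I" and g: "\<And>n b. b \<in> G n \<Longrightarrow> x \<in> b \<Longrightarrow> g (k, n, b) = 1"
  shows "(\<Sum>\<^sub>\<infinity>i\<in>{i\<in>I. g i > 0}. ennreal (g i)) = \<infinity>"
proof -
  define T where "T = {i \<in> {k} \<times> Sigma UNIV G. x \<in> snd (snd i)}"
  have gT: "g i = 1" if "i \<in> T" for i using that g by (auto simp: T_def)
  have "{n. x \<in> \<Union>(G n)} \<subseteq> (fst \<circ> snd) ` T"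
  proof
    fix n assume "n \<in> {n. x \<in> \<Union>(G n)}"
    then obtain b where "b \<in> G n" "x \<in> b" by auto
    then show "n \<in> (fst \<circ> snd) ` T" by (intro image_eqI[of _ _ "(k, n, b)"]) (auto simp: T_def)
  qed
  then have "infinite T" using inf finite_subset[OF _ finite_imageI] by metis
  then have "(\<Sum>\<^sub>\<infinity>i\<in>T. ennreal (g i)) = \<infinity>"
    by (intro infsum_superconst_infinite_ennreal[of _ 1]) (auto simp: gT)
  moreover have "(\<Sum>\<^sub>\<infinity>i\<in>T. ennreal (g i)) \<le> (\<Sum>\<^sub>\<infinity>i\<in>{i\<in>I. g i > 0}. ennreal (g i))"
  proof (rule infsum_mono_neutral)
    have "T \<subseteq> {i\<in>I. g i > 0}"
    proof
      fix i assume i: "i \<in> T"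
      then have "i \<in> I" using subsetD[OF sub, of i] unfolding T_def by simp
      then show "i \<in> {i\<in>I. g i > 0}" using gT[OF i] by simp
    qed
    then show "ennreal (g i) \<le> 0" if "i \<in> T - {i\<in>I. g i > 0}" for i using that by blast
  qed (simp_all add: nonneg_summable_on_complete)
  ultimately show ?thesis by (simp add: top_unique)
qed

lemma term_series_pointwise:
  fixes F :: "nat \<Rightarrow> real"
  assumes Q: "\<And>n. disjoint (Q n)" "\<And>n. x \<in> \<Union>(Q n)" and G: "\<And>n. disjoint (G n)"
    and D: "\<And>n q. q \<in> Q n \<Longrightarrow> x \<in> q \<Longrightarrow> D n q = F n - (if n = 0 then 0 else F (n - 1))"
    and near: "\<And>n. x \<notin> \<Union>(G n) \<Longrightarrow> \<bar>F n - y\<bar> \<le> (1/2) ^ n"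
  shows "has_abs_sum (\<lambda>i. term_coeff D i * indicator (snd (snd i)) x) (term_index Q G) y \<or>
         completely_divergent (\<lambda>i. term_coeff D i * indicator (snd (snd i)) x) (term_index Q G)"
proof -
  let ?N = "{n. x \<in> \<Union>(G n)}"
  let ?g = "\<lambda>i. term_coeff D i * indicator (snd (snd i)) x"
  show ?thesis
  proof (cases "finite ?N")
    case True
    have "((\<lambda>n. F n - (if n = 0 then 0 else F (n - 1))) has_sum y) UNIV"
      by (rule telescoping_has_sum[OF True]) (use near in auto)
    moreover have U: "{n. x \<in> \<Union>(Q n)} = UNIV" using Q(2) by auto
    ultimately have "((\<lambda>n. F n - (if n = 0 then 0 else F (n - 1))) has_sum y) {n. x \<in> \<Union>(Q n)}" by simp
    from has_sum_levels[where k = 1 and x = x and Q = Q and D = D, OF Q(1) D this]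
    have 1: "(?g has_sum y) ({1} \<times> Sigma UNIV Q)"
      by (rule has_sum_cong[THEN iffD1, rotated]) (auto simp: term_coeff_def)
    have c: "((\<lambda>n. e) has_sum (real (card ?N) * e)) ?N" for e :: real
      using has_sum_finite[OF True, of "\<lambda>_. e"] by simp
    have 2: "(?g has_sum (real (card ?N) * 1)) ({2} \<times> Sigma UNIV G)"
      using has_sum_levels[where k = 2 and x = x and Q = G and D = "\<lambda>_ _. 1", OF G _ c[of 1]]
      by (rule has_sum_cong[THEN iffD1, rotated]) (auto simp: term_coeff_def)
    have 3: "(?g has_sum (real (card ?N) * (-1))) ({3} \<times> Sigma UNIV G)"
      using has_sum_levels[where k = 3 and x = x and Q = G and D = "\<lambda>_ _. - 1", OF G _ c[of "- 1"]]
      by (rule has_sum_cong[THEN iffD1, rotated]) (auto simp: term_coeff_def)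
    have "(?g has_sum (y + (real (card ?N) * 1 + real (card ?N) * (-1)))) (term_index Q G)"
      unfolding term_index_def by (intro has_sum_Un_disjoint 1 2 3) auto
    then show ?thesis using has_abs_sumI by auto
  next
    case False
    have "(\<Sum>\<^sub>\<infinity>i\<in>{i\<in>term_index Q G. ?g i > 0}. ennreal (?g i)) = \<infinity>"
      by (rule infinite_levels_diverge[OF False, of 2]) (auto simp: term_index_def term_coeff_def)
    \<comment> \<open>The same argument for the negated terms, now using kind 3.\<close>
    moreover have "(\<Sum>\<^sub>\<infinity>i\<in>{i\<in>term_index Q G. - ?g i > 0}. ennreal (- ?g i)) = \<infinity>"
      by (rule infinite_levels_diverge[OF False, of 3]) (auto simp: term_index_def term_coeff_def)
    ultimately have "completely_divergent ?g (term_index Q G)"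
      unfolding completely_divergent_def neg_0_less_iff_less by blast
    then show ?thesis ..
  qed
qed

context interval_measure
begin

section \<open>Construction of the series\<close>

text \<open>The set where \<open>f\<close> and \<open>F\<close> differ by more than
  \<open>\<delta>\<close> need not be a countable union of members. \<open>G\<close> is instead
  obtained from the members of a cover whose fibres contain two values more than
  \<open>\<delta>\<close> apart. This covers that set and makes its mass accessible to the
  oscillation of the envelope.\<close>

lemma ex_partition_approximation:
  assumes env: "envelope X \<SS> \<A>" "graph_on X f \<subseteq> \<A>" and W: "spart W P0"
  shows "\<exists>F P G. spart W P \<and> (\<forall>p\<in>P. \<exists>v\<in>const_fibre \<A> p. \<forall>x\<in>p. F x = v) \<and>
     spart (\<Union>G) G \<and> \<Union>G \<subseteq> W \<and>
     (\<forall>b\<in>G. \<exists>v\<in>const_fibre \<A> b. \<exists>v'\<in>const_fibre \<A> b. \<bar>v - v'\<bar> > \<delta>) \<and>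
     (\<forall>x\<in>W. \<bar>f x - F x\<bar> > \<delta> \<longrightarrow> x \<in> \<Union>G)"
proof -
  obtain P where P: "spart W P" "\<And>p. p \<in> P \<Longrightarrow> \<exists>x\<in>W. f x \<in> const_fibre \<A> p"
    using pcov_imp_spart[OF pcov_envelope[OF env W]] by auto
  note P' = spartD[OF P(1)]
  from P(2) obtain t where t: "\<And>p. p \<in> P \<Longrightarrow> f (t p) \<in> const_fibre \<A> p" by metis
  define F where "F x = f (t (SOME p. p \<in> P \<and> x \<in> p))" for x
  have F: "F x = f (t p)" if p: "p \<in> P" "x \<in> p" for x p
  proof -
    have "(SOME p. p \<in> P \<and> x \<in> p) = p"
    proof (rule some_equality)
      fix p' assume p': "p' \<in> P \<and> x \<in> p'"
      show "p' = p" using disjointD[OF P'(2), of p' p] p p' by blast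
    qed (use p in auto)
    then show ?thesis by (simp add: F_def)
  qed
  \<comment> \<open>Refining the cover below \<open>P\<close> puts \<open>f x\<close> and
    \<open>F x\<close> into the fibre of one and the same set.\<close>
  have "pcov W (\<lambda>x p. f x \<in> const_fibre \<A> p \<and> (\<exists>q\<in>P. p \<subseteq> q))"
    by (intro pcov_conj pcov_envelope[OF env P(1)] pcov_spart[OF P(1)])
  then obtain \<Q> where Q: "countable \<Q>" "\<Q> \<subseteq> \<SS>" "\<Union>\<Q> = W"
     "\<And>x. x\<in>W \<Longrightarrow> \<exists>Q\<in>\<Q>. x \<in> Q \<and> (\<forall>P'. P' \<subseteq> Q \<longrightarrow> f x \<in> const_fibre \<A> P' \<and> (\<exists>q\<in>P. P' \<subseteq> q))"
    unfolding pcov_def by metis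
  define \<R> where "\<R> = {Q\<in>\<Q>. \<exists>v\<in>const_fibre \<A> Q. \<exists>v'\<in>const_fibre \<A> Q. \<bar>v - v'\<bar> > \<delta>}"
  have R: "countable \<R>" "\<R> \<subseteq> \<SS>" using Q(1,2) by (auto simp: \<R>_def)
  obtain G where G: "spart (\<Union>\<R>) G" "\<forall>b\<in>G. \<exists>q\<in>\<R>. b \<subseteq> q" using spart_of_cover[OF R] by auto
  have UG: "\<Union>G = \<Union>\<R>" using spartD(1)[OF G(1)] .
  show ?thesis
  proof (rule exI[of _ F], rule exI[of _ P], rule exI[of _ G], intro conjI ballI impI)
    show "spart W P" by fact
    show "spart (\<Union>G) G" unfolding UG by fact
    show "\<Union>G \<subseteq> W" unfolding UG using Q(3) by (auto simp: \<R>_def)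
  next
    fix p assume p: "p \<in> P"
    show "\<exists>v\<in>const_fibre \<A> p. \<forall>x\<in>p. F x = v" using t[OF p] F[OF p] by blast
  next
    fix b assume "b \<in> G"
    then obtain q where q: "q \<in> \<R>" "b \<subseteq> q" using G(2) by auto
    then obtain v v' where "v \<in> const_fibre \<A> q" "v' \<in> const_fibre \<A> q" "\<bar>v - v'\<bar> > \<delta>"
      by (auto simp: \<R>_def)
    then show "\<exists>v\<in>const_fibre \<A> b. \<exists>v'\<in>const_fibre \<A> b. \<bar>v - v'\<bar> > \<delta>"
      using mem_const_fibre_mono[OF _ q(2)] by blast
  next
    fix x assume x: "x \<in> W" "\<bar>f x - F x\<bar> > \<delta>"
    obtain Q where Q': "Q \<in> \<Q>" "x \<in> Q" "f x \<in> const_fibre \<A> Q" "\<exists>q\<in>P. Q \<subseteq> q" using Q(4)[OF x(1)] by blast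
    then obtain p where p: "p \<in> P" "Q \<subseteq> p" by auto
    have "F x = f (t p)" using F[OF p(1)] p(2) Q'(2) by blast
    then have "F x \<in> const_fibre \<A> Q" using mem_const_fibre_mono[OF t[OF p(1)] p(2)] by simp
    then have "Q \<in> \<R>" using Q' x(2) by (auto simp: \<R>_def)
    then show "x \<in> \<Union>G" unfolding UG using Q'(2) by blast
  qed
qed

text \<open>A Chebyshev-type estimate: exchanging the two distant values on each set costs at least
  \<open>\<delta>\<close> times its mass.\<close>

lemma small_mass:
  assumes env: "envelope X \<SS> \<A>" "osc_le \<A> d" and d: "\<delta> > 0"
    and I: "finite I" "disjoint_family_on A I" and A: "\<And>i. i \<in> I \<Longrightarrow> A i \<in> \<SS>"
    and v: "\<And>i. i \<in> I \<Longrightarrow> \<exists>v\<in>const_fibre \<A> (A i). \<exists>v'\<in>const_fibre \<A> (A i). \<bar>v - v'\<bar> > \<delta>"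
  shows "(\<Sum>i\<in>I. \<bar>\<mu> (A i)\<bar>) \<le> d / \<delta>"
proof -
  obtain v v' where v: "\<And>i. i \<in> I \<Longrightarrow> v i \<in> const_fibre \<A> (A i)" "\<And>i. i \<in> I \<Longrightarrow> v' i \<in> const_fibre \<A> (A i)"
    "\<And>i. i \<in> I \<Longrightarrow> \<bar>v i - v' i\<bar> > \<delta>" using v by metis
  have "\<delta> * (\<Sum>i\<in>I. \<bar>\<mu> (A i)\<bar>) \<le> (\<Sum>i\<in>I. \<bar>(v i - v' i) * \<mu> (A i)\<bar>)"
    unfolding sum_distrib_left abs_mult
    by (intro sum_mono mult_right_mono) (use v(3) in \<open>auto intro: less_imp_le\<close>)
  also have "\<dots> \<le> d" by (rule osc_bound[OF env I A v(1,2)])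
  finally show ?thesis using d by (simp add: field_simps)
qed

lemma svar_memI:
  assumes "finite T" "\<And>t. t \<in> T \<Longrightarrow> A t \<in> \<SS>" "disjoint_family_on A T"
  shows "(\<Sum>t\<in>T. indef f (A t)) \<in> svar X \<SS> \<mu> f"
proof -
  define h where "h = to_nat_on T"
  have inj: "inj_on h T" unfolding h_def using assms(1) by (simp add: countable_finite inj_on_to_nat_on)
  define k where "k = the_inv_into T h"
  have kh: "k (h i) = i" if "i \<in> T" for i
    unfolding k_def by (rule the_inv_into_f_f[OF inj that])
  have "(\<Sum>t\<in>T. indef f (A t)) = (\<Sum>j\<in>h ` T. the_env_integral X \<SS> \<mu> (restrict_zero f (A (k j))))"
    by (simp add: sum.reindex[OF inj] kh indef_def)
  moreover have "disjoint_family_on (\<lambda>j. A (k j)) (h ` T)"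
    using assms(3) kh unfolding disjoint_family_on_def by (metis imageE)
  moreover have "\<forall>j\<in>h ` T. A (k j) \<in> \<SS>" using assms(2) kh by auto
  moreover have "finite (h ` T)" using assms(1) by simp
  ultimately show ?thesis
    unfolding svar_def by (intro subsetD[OF closure_subset] CollectI exI[of _ "h ` T"] exI[of _ "\<lambda>j. A (k j)"]) simp
qed

end

section \<open>The semivariation of the series\<close>

lemma sum_half_powers_le: "(\<Sum>n<N. (1/2::real) ^ n) \<le> 2"
proof -
  have "(\<Sum>n<N. (1/2::real) ^ n) = 2 - 2 * (1/2) ^ N" by (induction N) auto
  then show ?thesis by simp
qed

lemma mem_term_index:
  "(k, n, q) \<in> term_index Q G \<longleftrightarrow> k = 1 \<and> q \<in> Q n \<or> (k = 2 \<or> k = 3) \<and> q \<in> G n"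
  by (auto simp: term_index_def)

text \<open>The index \<open>h t\<close> is the pair (kind, level). The factor 6 is 3 kinds times
  the bound 2 for the geometric series over the levels.\<close>

lemma finite_sum_blocks_le:
  fixes g :: "'t \<Rightarrow> real" and h :: "'t \<Rightarrow> nat \<times> nat"
  assumes T: "finite T" and h: "\<And>t. t \<in> T \<Longrightarrow> fst (h t) \<in> {1, 2, 3}" and b: "b \<ge> 0"
    and block: "\<And>y. y \<in> h ` T \<Longrightarrow> (\<Sum>t\<in>{t\<in>T. h t = y}. g t) \<le> b * (1/2) ^ snd y"
  shows "(\<Sum>t\<in>T. g t) \<le> 6 * b"
proof -
  have fin: "finite (h ` T)" using T by simp
  obtain N where N: "\<forall>n\<in>snd ` h ` T. n < N"
    using finite_imageI[OF fin, of snd] finite_nat_set_iff_bounded[of "snd ` h ` T"] by blast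
  have sub: "h ` T \<subseteq> {1, 2, 3} \<times> {..<N}"
  proof
    fix y assume y: "y \<in> h ` T"
    have "fst y \<in> {1, 2, 3}" using y h by blast
    moreover have "snd y < N" using N y by blast
    ultimately show "y \<in> {1, 2, 3} \<times> {..<N}" unfolding mem_Times_iff by simp
  qed
  have "(\<Sum>t\<in>T. g t) = (\<Sum>y\<in>h ` T. \<Sum>t\<in>{t\<in>T. h t = y}. g t)" by (rule sum.image_gen[OF T])
  also have "\<dots> \<le> (\<Sum>y\<in>h ` T. b * (1/2) ^ snd y)" by (rule sum_mono[OF block])
  also have "\<dots> \<le> (\<Sum>y\<in>{1::nat, 2, 3} \<times> {..<N}. b * (1/2) ^ snd y)"
    by (rule sum_mono2) (use sub b in auto)
  also have "\<dots> = (\<Sum>k\<in>{1::nat, 2, 3}. \<Sum>n<N. b * (1/2) ^ n)"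
    unfolding sum.cartesian_product by (simp only: case_prod_unfold)
  also have "\<dots> = 3 * b * (\<Sum>n<N. (1/2) ^ n)" by (simp add: sum_distrib_left algebra_simps)
  also have "\<dots> \<le> 3 * b * 2" by (rule mult_left_mono[OF sum_half_powers_le]) (use b in simp)
  finally show ?thesis by simp
qed

text \<open>The approximants enter only through constants on the blocks: \<open>v n q\<close> stands
  for the value of \<open>F\<^sub>n\<close> on \<open>q\<close> and \<open>v' n q\<close> for that
  of \<open>F\<^sub>n\<^sub>-\<^sub>1\<close>. At level 0 truncated subtraction makes
  \<open>\<A> (n - 1)\<close> the envelope \<open>\<A> 0\<close>, and \<open>D\<close> omits
  \<open>v'\<close>.\<close>

locale term_series = interval_measure +
  fixes f :: "'a \<Rightarrow> real" and \<A> :: "nat \<Rightarrow> (real \<times> 'a) set" and \<eta> :: real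
    and Q G :: "nat \<Rightarrow> 'a set set" and D v :: "nat \<Rightarrow> 'a set \<Rightarrow> real" and v' :: "nat \<Rightarrow> 'a set \<Rightarrow> real"
  assumes f: "env_integrable X \<SS> \<mu> f" and eta: "\<eta> > 0"
    and env: "envelope X \<SS> (\<A> n)" "graph_on X f \<subseteq> \<A> n" "osc_le (\<A> n) (\<eta> * (1/4) ^ n)"
    and Q: "disjoint (Q n)" and G: "disjoint (G n)"
    and D: "D n q = v n q - (if n = 0 then 0 else v' n q)"
    and v: "q \<in> Q n \<Longrightarrow> v n q \<in> const_fibre (\<A> n) q" "q \<in> Q n \<Longrightarrow> v' n q \<in> const_fibre (\<A> (n - 1)) q"
    and gap: "b \<in> G n \<Longrightarrow> \<exists>v\<in>const_fibre (\<A> n) b. \<exists>v'\<in>const_fibre (\<A> n) b. \<bar>v - v'\<bar> > (1/2) ^ n"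
begin

text \<open>Only kind 1 at level 0 carries integrals of \<open>f\<close>. At higher levels both
  \<open>v n\<close> and \<open>v' n\<close> satisfy a Saks-Henstock estimate with the same
  integrals, which cancel in the difference. The factor 5 arises from 4^(-n) + 4^(-(n-1)) = 5 *
  4^(-n). For kinds 2 and 3 the mass of the bad sets is used.\<close>

lemma block_bound:
  assumes T: "finite T" "disjoint_family_on A T" "\<And>t. t \<in> T \<Longrightarrow> A t \<in> \<SS>"
    and q: "\<And>t. t \<in> T \<Longrightarrow> (k, n, q t) \<in> term_index Q G" "\<And>t. t \<in> T \<Longrightarrow> A t \<subseteq> q t"
  shows "(\<Sum>t\<in>T. \<bar>term_coeff D (k, n, q t) * \<mu> (A t) - (if k = 1 \<and> n = 0 then indef f (A t) else 0)\<bar>)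
      \<le> 5 * \<eta> * (1/2) ^ n"
proof -
  have le: "(1/4::real) ^ n \<le> (1/2) ^ n" by (rule power_mono) auto
  show ?thesis
  proof (cases "k = 1")
    case True
    have qQ: "q t \<in> Q n" if "t \<in> T" for t using q(1)[OF that] True by (auto simp: mem_term_index)
    have 1: "(\<Sum>t\<in>T. \<bar>v n (q t) * \<mu> (A t) - indef f (A t)\<bar>) \<le> \<eta> * (1/4) ^ n"
      by (rule henstock[OF f env T]) (use mem_const_fibre_mono[OF v(1)[OF qQ] q(2)] in auto)
    show ?thesis
    proof (cases "n = 0")
      case n: True
      have "(\<Sum>t\<in>T. \<bar>term_coeff D (k, n, q t) * \<mu> (A t) - (if k = 1 \<and> n = 0 then indef f (A t) else 0)\<bar>)
          = (\<Sum>t\<in>T. \<bar>v n (q t) * \<mu> (A t) - indef f (A t)\<bar>)"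
        using True n by (simp add: term_coeff_def D)
      then show ?thesis using 1 n eta by simp
    next
      case n: False
      have 2: "(\<Sum>t\<in>T. \<bar>v' n (q t) * \<mu> (A t) - indef f (A t)\<bar>) \<le> \<eta> * (1/4) ^ (n - 1)"
        by (rule henstock[OF f env T]) (use mem_const_fibre_mono[OF v(2)[OF qQ] q(2)] in auto)
      have "(\<Sum>t\<in>T. \<bar>term_coeff D (k, n, q t) * \<mu> (A t) - (if k = 1 \<and> n = 0 then indef f (A t) else 0)\<bar>)
          \<le> (\<Sum>t\<in>T. \<bar>v n (q t) * \<mu> (A t) - indef f (A t)\<bar> + \<bar>v' n (q t) * \<mu> (A t) - indef f (A t)\<bar>)"
        using True n by (intro sum_mono) (simp add: term_coeff_def D left_diff_distrib)
      also have "\<dots> \<le> \<eta> * (1/4) ^ n + \<eta> * (1/4) ^ (n - 1)"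
        unfolding sum.distrib by (rule add_mono[OF 1 2])
      also have "\<dots> = 5 * \<eta> * (1/4) ^ n" using n by (cases n) auto
      also have "\<dots> \<le> 5 * \<eta> * (1/2) ^ n" by (rule mult_left_mono[OF le]) (use eta in simp)
      finally show ?thesis .
    qed
  next
    case False
    have qG: "q t \<in> G n" if "t \<in> T" for t using q(1)[OF that] False by (auto simp: mem_term_index)
    have "(\<Sum>t\<in>T. \<bar>term_coeff D (k, n, q t) * \<mu> (A t) - (if k = 1 \<and> n = 0 then indef f (A t) else 0)\<bar>)
        = (\<Sum>t\<in>T. \<bar>\<mu> (A t)\<bar>)"
      using False by (intro sum.cong) (auto simp: term_coeff_def)
    also have "\<dots> \<le> \<eta> * (1/4) ^ n / (1/2) ^ n"
    proof (rule small_mass[OF env(1,3) _ T])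
      fix t assume t: "t \<in> T"
      show "\<exists>v\<in>const_fibre (\<A> n) (A t). \<exists>v'\<in>const_fibre (\<A> n) (A t). (1/2) ^ n < \<bar>v - v'\<bar>"
        using gap[OF qG[OF t]] mem_const_fibre_mono[OF _ q(2)[OF t]] by blast
    qed simp
    also have "\<dots> = \<eta> * (1/2) ^ n"
    proof -
      have "(1/4::real) ^ n = (1/2) ^ n * (1/2) ^ n" by (simp flip: power_mult_distrib)
      then show ?thesis by simp
    qed
    also have "\<dots> \<le> 5 * \<eta> * (1/2) ^ n" using eta by simp
    finally show ?thesis .
  qed
qed

text \<open>An element of the left side is nearly a finite sum of terms
  \<open>?c i * \<mu> (A i j)\<close>. Grouped by kind and level, these are handled by
  \<open>block_bound\<close>; the group of kind 1 and level 0 leaves a sum of integrals over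
  disjoint sets, which belongs to the semivariation of \<open>f\<close>.\<close>

lemma set_family_sum_subset:
  "set_family_sum (term_index Q G) (\<lambda>i. svar_const \<SS> \<mu> (term_coeff D i) (snd (snd i)))
     \<subseteq> svar X \<SS> \<mu> f + {-(60 * \<eta>)<..<60 * \<eta>}"
proof
  let ?I = "term_index Q G" and ?c = "term_coeff D"
  fix z assume "z \<in> set_family_sum ?I (\<lambda>i. svar_const \<SS> \<mu> (?c i) (snd (snd i)))"
  then obtain a where z: "z = (\<Sum>i\<in>{i. i \<in> ?I \<and> a i \<noteq> 0}. a i)"
    and a: "\<forall>i\<in>?I. a i \<in> svar_const \<SS> \<mu> (?c i) (snd (snd i))" and "finite {i. i \<in> ?I \<and> a i \<noteq> 0}"
    unfolding set_family_sum_def by blast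
  define L where "L = {i. i \<in> ?I \<and> a i \<noteq> 0}"
  have L: "finite L" "L \<subseteq> ?I" using \<open>finite {i. i \<in> ?I \<and> a i \<noteq> 0}\<close> by (auto simp: L_def)
  \<comment> \<open>Each closure is approximated within \<open>e\<close>, for a total error of at
    most \<open>\<eta>\<close>.\<close>
  define e where "e = \<eta> / (card L + 1)"
  have e: "e > 0" using eta by (simp add: e_def)
  have ce: "card L * e \<le> \<eta>" using eta by (simp add: e_def field_simps)
  define near_sum where "near_sum i J A \<longleftrightarrow>
      finite (J :: nat set) \<and> (\<forall>j\<in>J. A j \<in> \<SS> \<and> A j \<subseteq> snd (snd i)) \<and> disjoint_family_on A J \<and>
      dist (\<Sum>j\<in>J. ?c i * \<mu> (A j)) (a i) < e" for i J A
  have "\<exists>J A. near_sum i J A" if i: "i \<in> L" for i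
  proof -
    have "a i \<in> svar_const \<SS> \<mu> (?c i) (snd (snd i))" using a i L(2) by blast
    then have "\<exists>y\<in>{(\<Sum>j\<in>J. ?c i * \<mu> (A j)) | J A. finite (J :: nat set) \<and>
        (\<forall>j\<in>J. A j \<in> \<SS> \<and> A j \<subseteq> snd (snd i)) \<and> disjoint_family_on A J}. dist y (a i) < e"
      using e unfolding svar_const_def closure_approachable by meson
    then obtain J A where "finite (J :: nat set)" "\<forall>j\<in>J. A j \<in> \<SS> \<and> A j \<subseteq> snd (snd i)"
      "disjoint_family_on A J" "dist (\<Sum>j\<in>J. ?c i * \<mu> (A j)) (a i) < e"
      by (smt (verit, best) mem_Collect_eq)
    then have "near_sum i J A" by (simp only: near_sum_def simp_thms)
    then show ?thesis by (intro exI)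
  qed
  then obtain J A where JA: "\<And>i. i \<in> L \<Longrightarrow> near_sum i (J i) (A i)" by metis
  have J: "\<And>i. i \<in> L \<Longrightarrow> finite (J i)"
    and A: "\<And>i j. i \<in> L \<Longrightarrow> j \<in> J i \<Longrightarrow> A i j \<in> \<SS>" "\<And>i j. i \<in> L \<Longrightarrow> j \<in> J i \<Longrightarrow> A i j \<subseteq> snd (snd i)"
    and disj: "\<And>i. i \<in> L \<Longrightarrow> disjoint_family_on (A i) (J i)"
    and near: "\<And>i. i \<in> L \<Longrightarrow> dist (\<Sum>j\<in>J i. ?c i * \<mu> (A i j)) (a i) < e"
    using JA by (simp_all add: near_sum_def)
  define T where "T = Sigma L J"
  define B where "B t = A (fst t) (snd t)" for t
  define h where "h t = (fst (fst t), fst (snd (fst t)))" for t :: "(nat \<times> nat \<times> 'a set) \<times> nat"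
  define m where "m t = (if h t = (1, 0) then indef f (B t) else 0)" for t
  have T: "finite T" using L(1) J by (auto simp: T_def)
  have BS: "B t \<in> \<SS>" "B t \<subseteq> snd (snd (fst t))" "fst t \<in> ?I" if "t \<in> T" for t
  proof -
    have "fst t \<in> L" "snd t \<in> J (fst t)" using that by (auto simp: T_def)
    then show "B t \<in> \<SS>" "B t \<subseteq> snd (snd (fst t))" "fst t \<in> ?I" using A L(2) unfolding B_def by blast+
  qed
  \<comment> \<open>Disjointness holds only within one kind and level; sets of different levels
    overlap. Terms from the same block are disjoint by the choice of \<open>A\<close>, terms from
    different blocks because the blocks are.\<close>
  have dT: "disjoint_family_on B {t\<in>T. h t = y}" for y
    unfolding disjoint_family_on_def
  proof (intro ballI impI)
    fix t u assume t: "t \<in> {t\<in>T. h t = y}" and u: "u \<in> {t\<in>T. h t = y}" and ne: "t \<noteq> u"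
    obtain k n p i where t': "t = ((k, n, p), i)" by (cases t) auto
    obtain q j where u': "u = ((k, n, q), j)" using t u t' by (cases u) (auto simp: h_def)
    show "B t \<inter> B u = {}"
    proof (cases "p = q")
      case True
      then have "i \<noteq> j" using ne t' u' by auto
      moreover have "(k, n, p) \<in> L" "i \<in> J (k, n, p)" "j \<in> J (k, n, p)"
        using t u t' u' True by (auto simp: T_def)
      ultimately show ?thesis using disj[of "(k, n, p)"] True
        by (auto simp: disjoint_family_on_def B_def t' u')
    next
      case False
      have "(k, n, p) \<in> ?I" "(k, n, q) \<in> ?I" using BS(3)[of t] BS(3)[of u] t u t' u' by auto
      then have "p \<inter> q = {}"
        using disjointD[OF Q[of n] _ _ False] disjointD[OF G[of n] _ _ False]
        unfolding mem_term_index by auto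
      moreover have "B t \<subseteq> p" "B u \<subseteq> q" using BS(2)[of t] BS(2)[of u] t u t' u' by auto
      ultimately show ?thesis by blast
    qed
  qed
  have "(\<Sum>t\<in>T. \<bar>?c (fst t) * \<mu> (B t) - m t\<bar>) \<le> 6 * (5 * \<eta>)"
  proof (rule finite_sum_blocks_le[OF T])
    show "fst (h t) \<in> {1, 2, 3}" if "t \<in> T" for t
      using BS(3)[OF that] by (cases t) (auto simp: h_def term_index_def)
    show "0 \<le> 5 * \<eta>" using eta by simp
    fix y assume "y \<in> h ` T"
    obtain k n where y: "y = (k, n)" by (cases y)
    have ft: "fst t = (k, n, snd (snd (fst t)))" if "t \<in> {t\<in>T. h t = y}" for t
      using that y by (cases t) (auto simp: h_def)
    have "(\<Sum>t\<in>{t\<in>T. h t = y}. \<bar>?c (fst t) * \<mu> (B t) - m t\<bar>) =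
      (\<Sum>t\<in>{t\<in>T. h t = y}. \<bar>?c (k, n, snd (snd (fst t))) * \<mu> (B t) - (if k = 1 \<and> n = 0 then indef f (B t) else 0)\<bar>)"
    proof (rule sum.cong[OF refl])
      fix t assume t: "t \<in> {t\<in>T. h t = y}"
      have "m t = (if k = 1 \<and> n = 0 then indef f (B t) else 0)" using t y by (simp add: m_def)
      then show "\<bar>?c (fst t) * \<mu> (B t) - m t\<bar> =
          \<bar>?c (k, n, snd (snd (fst t))) * \<mu> (B t) - (if k = 1 \<and> n = 0 then indef f (B t) else 0)\<bar>"
        unfolding ft[OF t, symmetric] by (simp only:)
    qed
    also have "\<dots> \<le> 5 * \<eta> * (1/2) ^ n"
    proof (rule block_bound[OF _ dT])
      show "(k, n, snd (snd (fst t))) \<in> ?I" if "t \<in> {t\<in>T. h t = y}" for t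
        unfolding ft[OF that, symmetric] using BS(3) that by simp
    next
      show "finite {t\<in>T. h t = y}" using T by simp
      show "B t \<in> \<SS>" "B t \<subseteq> snd (snd (fst t))" if "t \<in> {t\<in>T. h t = y}" for t
        using BS(1,2) that by blast+
    qed
    finally show "(\<Sum>t\<in>{t\<in>T. h t = y}. \<bar>?c (fst t) * \<mu> (B t) - m t\<bar>) \<le> 5 * \<eta> * (1/2) ^ snd y"
      by (simp add: y)
  qed
  then have 1: "\<bar>(\<Sum>t\<in>T. ?c (fst t) * \<mu> (B t)) - (\<Sum>t\<in>T. m t)\<bar> \<le> 30 * \<eta>"
    using sum_abs[of "\<lambda>t. ?c (fst t) * \<mu> (B t) - m t" T] by (simp add: sum_subtractf)
  have "(\<Sum>t\<in>T. ?c (fst t) * \<mu> (B t)) = (\<Sum>i\<in>L. \<Sum>j\<in>J i. ?c i * \<mu> (A i j))"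
    unfolding T_def B_def by (rule sum_fst_Sigma[symmetric, OF L(1) J])
  then have "\<bar>(\<Sum>t\<in>T. ?c (fst t) * \<mu> (B t)) - z\<bar> = \<bar>\<Sum>i\<in>L. (\<Sum>j\<in>J i. ?c i * \<mu> (A i j)) - a i\<bar>"
    by (simp add: z L_def[symmetric] sum_subtractf)
  also have "\<dots> \<le> (\<Sum>i\<in>L. \<bar>(\<Sum>j\<in>J i. ?c i * \<mu> (A i j)) - a i\<bar>)" by (rule sum_abs)
  also have "\<dots> \<le> (\<Sum>i\<in>L. e)" using near by (intro sum_mono) (auto simp: dist_real_def intro: less_imp_le)
  \<comment> \<open>The total error is at most 30 + 1 times \<open>\<eta>\<close>, strictly below
    the generous bound 60.\<close>
  also have "\<dots> \<le> \<eta>" using ce by simp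
  finally have 2: "\<bar>z - (\<Sum>t\<in>T. m t)\<bar> < 60 * \<eta>" using 1 eta by linarith
  have "(\<Sum>t\<in>T. m t) = (\<Sum>t\<in>{t\<in>T. h t = (1, 0)}. indef f (B t))"
    unfolding m_def by (rule sum.inter_filter[OF T, symmetric])
  also have "\<dots> \<in> svar X \<SS> \<mu> f"
    by (rule svar_memI[OF _ _ dT]) (use T BS(1) in auto)
  finally have "(\<Sum>t\<in>T. m t) + (z - (\<Sum>t\<in>T. m t)) \<in> svar X \<SS> \<mu> f + {-(60 * \<eta>)<..<60 * \<eta>}"
    by (rule set_plus_intro) (use 2 in auto)
  then show "z \<in> svar X \<SS> \<mu> f + {-(60 * \<eta>)<..<60 * \<eta>}" by simp
qed

end

theorem lemma14p6:
  fixes X :: "'a set" and \<SS> :: "'a set set" and \<mu> :: "'a set \<Rightarrow> real"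
    and f :: "'a \<Rightarrow> real" and \<epsilon> :: real
  assumes "interval_system X \<SS>"
    and "abs_additive_measure \<SS> \<mu>"
    and "env_integrable X \<SS> \<mu> f"
    and "bounded (svar X \<SS> \<mu> f)"
    and "\<epsilon> > 0"
  shows "\<exists>(\<Lambda> :: nat set) (c :: nat \<Rightarrow> real) (E :: nat \<Rightarrow> 'a set).
           (\<forall>l\<in>\<Lambda>. E l \<in> \<SS>) \<and>
           (\<forall>x\<in>X. has_abs_sum (\<lambda>l. c l * indicator (E l) x) \<Lambda> (f x) \<or>
                  completely_divergent (\<lambda>l. c l * indicator (E l) x) \<Lambda>) \<and>
           set_family_sum \<Lambda> (\<lambda>l. svar_const \<SS> \<mu> (c l) (E l))
             \<subseteq> svar X \<SS> \<mu> f + {-\<epsilon><..<\<epsilon>}"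
proof -
  interpret interval_measure X \<SS> \<mu> using assms(1,2) by unfold_locales
  define \<eta> where "\<eta> = \<epsilon> / 60"
  have eta: "\<eta> > 0" using assms(5) by (simp add: \<eta>_def)
  obtain a where a: "has_env_integral X \<SS> \<mu> f a" using assms(3) by (auto simp: env_integrable_def)
  have "\<exists>\<A>. envelope X \<SS> \<A> \<and> graph_on X f \<subseteq> \<A> \<and> osc_le \<A> (\<eta> * (1/4) ^ n)" for n
  proof -
    have "\<eta> * (1/4) ^ n > 0" using eta by simp
    from has_env_integral_osc[OF a this] show ?thesis by metis
  qed
  then obtain \<A> where env: "\<And>n. envelope X \<SS> (\<A> n)" "\<And>n. graph_on X f \<subseteq> \<A> n"
    "\<And>n. osc_le (\<A> n) (\<eta> * (1/4) ^ n)" by metis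
  \<comment> \<open>The cover belonging to \<open>\<A> 0\<close> serves as support: outside it this
    envelope allows only the value 0, so \<open>f\<close> vanishes there.\<close>
  obtain \<D> where D: "countable \<D>" "\<D> \<subseteq> \<SS>"
    and A0: "\<A> 0 = (\<Union>D\<in>\<D>. const_fibre (\<A> 0) D \<times> D) \<union> ({0} \<times> (X - \<Union>\<D>))"
    using env(1)[of 0] unfolding envelope_def by auto
  define W where "W = \<Union>\<D>"
  have f0: "f x = 0" if x: "x \<in> X" "x \<notin> W" for x
  proof -
    have "(f x, x) \<in> \<A> 0" using env(2)[of 0] x(1) by (auto simp: graph_on_def)
    then show ?thesis using x(2) by (subst (asm) A0) (auto simp: W_def)
  qed
  obtain P0 where P0: "spart W P0" using spart_of_cover[OF D] unfolding W_def by auto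
  \<comment> \<open>A single predicate allows \<open>F\<close>, \<open>P\<close> and
    \<open>G\<close> to be chosen for all levels at once.\<close>
  define good where "good n F P G \<longleftrightarrow> spart W P \<and> (\<forall>p\<in>P. \<exists>v\<in>const_fibre (\<A> n) p. \<forall>x\<in>p. F x = v) \<and>
     spart (\<Union>G) G \<and> \<Union>G \<subseteq> W \<and>
     (\<forall>b\<in>G. \<exists>v\<in>const_fibre (\<A> n) b. \<exists>v'\<in>const_fibre (\<A> n) b. \<bar>v - v'\<bar> > (1/2) ^ n) \<and>
     (\<forall>x\<in>W. \<bar>f x - F x\<bar> > (1/2) ^ n \<longrightarrow> x \<in> \<Union>G)" for n F P G
  have "\<exists>F P G. good n F P G" for n
    unfolding good_def by (rule ex_partition_approximation[OF env(1,2) P0])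
  then obtain F P G where good: "\<And>n. good n (F n) (P n) (G n)" by metis
  have gd: "spart W (P n)" "\<forall>p\<in>P n. \<exists>v\<in>const_fibre (\<A> n) p. \<forall>x\<in>p. F n x = v"
     "spart (\<Union>(G n)) (G n)" "\<Union>(G n) \<subseteq> W"
     "\<forall>b\<in>G n. \<exists>v\<in>const_fibre (\<A> n) b. \<exists>v'\<in>const_fibre (\<A> n) b. \<bar>v - v'\<bar> > (1/2) ^ n"
     "\<forall>x\<in>W. \<bar>f x - F n x\<bar> > (1/2) ^ n \<longrightarrow> x \<in> \<Union>(G n)" for n
    by (insert good[of n], unfold good_def, (elim conjE, assumption)+)
  note P = gd(1) bspec[OF gd(2)] and G = gd(3,4) bspec[OF gd(5)] gd(6)[rule_format]
  \<comment> \<open>\<open>Q n\<close> refines the partitions of two consecutive levels, so that the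
    difference of the two approximants is constant on each block. For \<open>n = 0\<close> both are
    \<open>P 0\<close>.\<close>
  have "\<exists>R. spart W R \<and> (\<forall>r\<in>R. (\<exists>p\<in>P n. r \<subseteq> p) \<and> (\<exists>p\<in>P (n - 1). r \<subseteq> p))" for n
    using spart_common[OF P(1)[of n] P(1)[of "n - 1"]] by simp
  then obtain Q where Q: "\<And>n. spart W (Q n)"
    and Q1: "\<And>n q. q \<in> Q n \<Longrightarrow> \<exists>p\<in>P n. q \<subseteq> p" "\<And>n q. q \<in> Q n \<Longrightarrow> \<exists>p\<in>P (n - 1). q \<subseteq> p" by metis
  have val: "val (F m) q \<in> const_fibre (\<A> m) q \<and> (\<forall>x\<in>q. F m x = val (F m) q)"
    if q: "q \<noteq> {}" "\<exists>p\<in>P m. q \<subseteq> p" for m q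
  proof -
    obtain p where p: "p \<in> P m" "q \<subseteq> p" using q(2) by auto
    obtain v where v: "v \<in> const_fibre (\<A> m) p" "\<forall>x\<in>p. F m x = v" using P(2)[OF p(1)] by auto
    have "val (F m) q = v" using v(2) subsetD[OF p(2), of "SOME x. x \<in> q"] q(1) some_in_eq[of q] unfolding val_def by simp
    then show ?thesis using v p(2) mem_const_fibre_mono[OF v(1) p(2)] by auto
  qed
  have ne: "q \<noteq> {}" if "q \<in> Q n" for n q using spartD(3)[OF Q[of n]] that by auto
  define D where "D n q = val (F n) q - (if n = 0 then 0 else val (F (n - 1)) q)" for n q
  interpret series: term_series X \<SS> \<mu> f \<A> \<eta> Q G D "\<lambda>n. val (F n)" "\<lambda>n. val (F (n - 1))"
  proof unfold_locales
    show "val (F n) q \<in> const_fibre (\<A> n) q" "val (F (n - 1)) q \<in> const_fibre (\<A> (n - 1)) q"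
      if "q \<in> Q n" for n q
      using val[OF ne[OF that] Q1(1)[OF that]] val[OF ne[OF that] Q1(2)[OF that]] by blast+
  qed (use assms(3) eta env D_def spartD(2)[OF Q] spartD(2)[OF G(1)] G(3) in auto)
  let ?I = "term_index Q G" and ?E = "\<lambda>i :: nat \<times> nat \<times> 'a set. snd (snd i)"
  have IE: "?E i \<in> \<SS>" "?E i \<subseteq> W" if i: "i \<in> ?I" for i
  proof -
    obtain k n q where kq: "i = (k, n, q)" by (cases i) auto
    then have "q \<in> Q n \<or> q \<in> G n" using i by (auto simp: mem_term_index)
    then show "?E i \<in> \<SS>" "?E i \<subseteq> W"
      using spartD(1,5)[OF Q[of n]] spartD(5)[OF G(1)[of n]] G(2)[of n] kq by auto
  qed
  show ?thesis
  proof (rule nat_indexed_families[where c = "term_coeff D" and E = ?E and I = ?I])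
    show "countable ?I" using spartD(4)[OF Q] spartD(4)[OF G(1)] unfolding term_index_def by simp
    show "?E i \<in> \<SS>" if "i \<in> ?I" for i using IE(1)[OF that] .
    show "set_family_sum ?I (\<lambda>i. svar_const \<SS> \<mu> (term_coeff D i) (?E i)) \<subseteq> svar X \<SS> \<mu> f + {-\<epsilon><..<\<epsilon>}"
      using series.set_family_sum_subset by (simp add: \<eta>_def)
    fix x assume x: "x \<in> X"
    show "has_abs_sum (\<lambda>i. term_coeff D i * indicator (?E i) x) ?I (f x) \<or>
        completely_divergent (\<lambda>i. term_coeff D i * indicator (?E i) x) ?I"
    proof (cases "x \<in> W")
      case True
      show ?thesis
      proof (rule term_series_pointwise[where F = "\<lambda>n. F n x"])
        show "disjoint (Q n)" "disjoint (G n)" for n using spartD(2)[OF Q] spartD(2)[OF G(1)] .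
        show "x \<in> \<Union>(Q n)" for n using spartD(1)[OF Q] True by simp
        show "D n q = F n x - (if n = 0 then 0 else F (n - 1) x)" if q: "q \<in> Q n" "x \<in> q" for n q
          using val[OF ne[OF q(1)] Q1(1)[OF q(1)]] val[OF ne[OF q(1)] Q1(2)[OF q(1)]] q(2)
          unfolding D_def by metis
        show "\<bar>F n x - f x\<bar> \<le> (1/2) ^ n" if "x \<notin> \<Union>(G n)" for n
        proof -
          have "\<not> \<bar>f x - F n x\<bar> > (1/2) ^ n" using G(4)[OF True] that by blast
          then show ?thesis by linarith
        qed
      qed
    next
      case False
      \<comment> \<open>All sets of the series lie in \<open>W\<close>, so outside it every term is
        0, in agreement with \<open>f x = 0\<close>.\<close>
      have "term_coeff D i * indicator (?E i) x = 0" if "i \<in> ?I" for i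
        using IE(2)[OF that] False by (auto simp: indicator_def)
      then have "((\<lambda>i. term_coeff D i * indicator (?E i) x) has_sum f x) ?I"
        unfolding f0[OF x False] by (rule has_sum_0)
      then show ?thesis using has_abs_sumI by blast
    qed
  qed
qed

end
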